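(* Let $\mathcal{C}$ be a Markov category with conditionals and let $p$ be a hidden Markov model in $\mathcal{C}$ with transition kernels $f_t\colon X_{t-1}\to X_t$ and observation kernels $g_t\colon X_t\to Y_t$, $t=0,\dots,n$ (with $X_{-1}=I$). Put $X_{n+1}:=I$, $f_{n+1}:=\mathrm{del}_{X_n}$ and $\mathrm{BS}^n_{n+1}:=\mathrm{del}_{Y_{[n]}}$. Then the Bayes smoother satisfies the following backwards recursion for all $t\in\{0,\dots,n\}$: $$\mathrm{BS}^n_t\;=_{p^Y_{[n]}\text{-a.s.}}\;k_t\circ(\mathrm{id}_{Y_{[t]}}\otimes\mathrm{BS}^n_{t+1})\circ(\mathrm{copy}_{Y_{[t]}}\otimes\mathrm{id}_{Y_{(t,n]}}),$$ where $k_t\colon Y_{[t]}\otimes X_{t+1}\to X_t$ is a conditional with respect to $X_{t+1}$ of $$(\mathrm{id}_{X_t}\otimes f_{t+1})\circ\mathrm{copy}_{X_t}\circ\mathrm{BF}_t\;\colon\;Y_{[t]}\to X_t\otimes X_{t+1}$$ (for any choice of Bayes filters, Bayes smoothers and conditionals).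
   Context: A Markov category is a symmetric monoidal category whose monoidal unit $I$ is terminal, in which every object $X$ carries a distinguished commutative comonoid structure $\mathrm{copy}_X\colon X\to X\otimes X$, $\mathrm{del}_X\colon X\to I$, compatible with $\otimes$. Coherence isomorphisms and symmetries are suppressed. Marginals are obtained by composing with $\mathrm{del}$ on some outputs. Conditionals: a conditional of $f\colon A\to X\otimes Y$ with respect to $Y$ is a morphism $f_{|Y}\colon A\otimes Y\to X$ such that $f$ equals the composite: copy $A$; apply to one copy the marginal $f_Y:=(\mathrm{del}_X\otimes\mathrm{id}_Y)\circ f$; copy the resulting $Y$; output one copy of $Y$ and apply $f_{|Y}$ to the other copy of $A$ and the other copy of $Y$ to produce $X$. $\mathcal{C}$ has conditionals if these always exist. Almost sure equality: for $q\colon W\to A$ and $a,b\colon A\to X$, $a=_{q\text{-a.s.}}b$ means $(\mathrm{id}_A\otimes a)\circ\mathrm{copy}_A\circ q=(\mathrm{id}_A\otimes b)\circ\mathrm{copy}_A\circ q$. Notation: $[t]=\{0,\dots,t\}$, $(t,n]=\{t+1,\dots,n\}$; $Y_{[t]}=Y_0\otimes\cdots\otimes Y_t$, $Y_{(t,n]}=Y_{t+1}\otimes\cdots\otimes Y_n$ (empty products are $I$). Hidden Markov model: given $f_t\colon X_{t-1}\to X_t$ and $g_t\colon X_t\to Y_t$ ($t=0,\dots,n$, $X_{-1}:=I$), it is the state $p\colon I\to\bigotimes_{t\in[n]}(X_t\otimes Y_t)$, $p=\big(\bigotimes_{t=0}^n((\mathrm{id}_{X_t}\otimes g_t)\circ\mathrm{copy}_{X_t})\big)\circ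 m_n$, where $m_0=f_0$ and $m_t=\big(\mathrm{id}_{X_0\otimes\cdots\otimes X_{t-2}}\otimes((\mathrm{id}_{X_{t-1}}\otimes f_t)\circ\mathrm{copy}_{X_{t-1}})\big)\circ m_{t-1}$. Write $p^Y_{[t]}$ for the marginal of $p$ on $Y_{[t]}$. Bayes filter: $\mathrm{BF}_t\colon Y_{[t]}\to X_t$ is a conditional, with respect to $Y_{[t]}$, of the marginal of $p$ on $Y_{[t]}\otimes X_t$. Bayes smoother: for $t\in[n]$, $\mathrm{BS}^n_t\colon Y_{[n]}\to X_t$ is a conditional, with respect to $Y_{[n]}$, of the marginal of $p$ on $Y_{[n]}\otimes X_t$; i.e. this marginal equals $(\mathrm{id}_{Y_{[n]}}\otimes\mathrm{BS}^n_t)\circ\mathrm{copy}_{Y_{[n]}}\circ p^Y_{[n]}$. They are unique up to $p^Y_{[t]}$-a.s. resp. $p^Y_{[n]}$-a.s. equality. *)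

theory Defs
  imports Main
begin

section \<open>Categories and symmetric monoidal categories\<close>

text \<open>
  Every element of \<open>'o\<close> is an object and every element of \<open>'m\<close> is a morphism with a unique source
  and target, so no carrier sets are needed. Composition is a total function that is only
  constrained by the axioms on composable pairs.
\<close>

record ('o, 'm) category_data =
  Src :: "'m \<Rightarrow> 'o"
  Tgt :: "'m \<Rightarrow> 'o"
  ident :: "'o \<Rightarrow> 'm" ("\<one>\<index>")
  compose :: "'m \<Rightarrow> 'm \<Rightarrow> 'm" (infixr "\<cdot>\<index>" 60)

definition Hom :: "('o, 'm, 'z) category_data_scheme \<Rightarrow> 'o \<Rightarrow> 'o \<Rightarrow> 'm set" where
  "Hom C A B = {f. Src C f = A \<and> Tgt C f = B}"

locale category =
  fixes C :: "('o, 'm, 'z) category_data_scheme" (structure)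
  assumes ident_hom: "\<one> A \<in> Hom C A A"
    and comp_hom: "f \<in> Hom C A B \<Longrightarrow> g \<in> Hom C B D \<Longrightarrow> g \<cdot> f \<in> Hom C A D"
    and comp_ident_left: "f \<in> Hom C A B \<Longrightarrow> \<one> B \<cdot> f = f"
    and comp_ident_right: "f \<in> Hom C A B \<Longrightarrow> f \<cdot> \<one> A = f"
    and comp_assoc: "f \<in> Hom C A B \<Longrightarrow> g \<in> Hom C B D \<Longrightarrow> h \<in> Hom C D E \<Longrightarrow>
      (h \<cdot> g) \<cdot> f = h \<cdot> (g \<cdot> f)"

text \<open>
  The category is not assumed to be strict. The inverses of the coherence isomorphisms are fields
  of the record, but they are determined by the axioms.
\<close>

record ('o, 'm) smc_data = "('o, 'm) category_data" +
  Unit :: "'o" ("\<I>\<index>")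
  tens_obj :: "'o \<Rightarrow> 'o \<Rightarrow> 'o" (infixl "\<odot>\<index>" 75)
  tens_mor :: "'m \<Rightarrow> 'm \<Rightarrow> 'm" (infixl "\<otimes>\<index>" 70)
  assoc :: "'o \<Rightarrow> 'o \<Rightarrow> 'o \<Rightarrow> 'm" ("\<alpha>\<index>")
  assoc_inv :: "'o \<Rightarrow> 'o \<Rightarrow> 'o \<Rightarrow> 'm" ("\<alpha>i\<index>")
  lunit :: "'o \<Rightarrow> 'm" ("\<ll>\<index>")
  lunit_inv :: "'o \<Rightarrow> 'm" ("\<ll>i\<index>")
  runit :: "'o \<Rightarrow> 'm" ("\<rr>\<index>")
  runit_inv :: "'o \<Rightarrow> 'm" ("\<rr>i\<index>")
  swap :: "'o \<Rightarrow> 'o \<Rightarrow> 'm" ("\<sigma>\<index>")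

locale symmetric_monoidal_category = category C
  for C :: "('o, 'm, 'z) smc_data_scheme" (structure) +
  assumes tens_hom: "f \<in> Hom C A B \<Longrightarrow> g \<in> Hom C A' B' \<Longrightarrow> f \<otimes> g \<in> Hom C (A \<odot> A') (B \<odot> B')"
    and tens_ident: "\<one> A \<otimes> \<one> B = \<one> (A \<odot> B)"
    and interchange: "f \<in> Hom C A B \<Longrightarrow> g \<in> Hom C B D \<Longrightarrow> f' \<in> Hom C A' B' \<Longrightarrow> g' \<in> Hom C B' D' \<Longrightarrow>
      (g \<otimes> g') \<cdot> (f \<otimes> f') = (g \<cdot> f) \<otimes> (g' \<cdot> f')"
    and assoc_hom: "\<alpha> A B D \<in> Hom C ((A \<odot> B) \<odot> D) (A \<odot> (B \<odot> D))"
    and assoc_inv_hom: "\<alpha>i A B D \<in> Hom C (A \<odot> (B \<odot> D)) ((A \<odot> B) \<odot> D)"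
    and assoc_inv_left: "\<alpha>i A B D \<cdot> \<alpha> A B D = \<one> ((A \<odot> B) \<odot> D)"
    and assoc_inv_right: "\<alpha> A B D \<cdot> \<alpha>i A B D = \<one> (A \<odot> (B \<odot> D))"
    and assoc_natural: "f \<in> Hom C A A' \<Longrightarrow> g \<in> Hom C B B' \<Longrightarrow> h \<in> Hom C D D' \<Longrightarrow>
      \<alpha> A' B' D' \<cdot> ((f \<otimes> g) \<otimes> h) = (f \<otimes> (g \<otimes> h)) \<cdot> \<alpha> A B D"
    and lunit_hom: "\<ll> A \<in> Hom C (\<I> \<odot> A) A"
    and lunit_inv_hom: "\<ll>i A \<in> Hom C A (\<I> \<odot> A)"
    and lunit_inv_left: "\<ll>i A \<cdot> \<ll> A = \<one> (\<I> \<odot> A)"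
    and lunit_inv_right: "\<ll> A \<cdot> \<ll>i A = \<one> A"
    and lunit_natural: "f \<in> Hom C A B \<Longrightarrow> \<ll> B \<cdot> (\<one> \<I> \<otimes> f) = f \<cdot> \<ll> A"
    and runit_hom: "\<rr> A \<in> Hom C (A \<odot> \<I>) A"
    and runit_inv_hom: "\<rr>i A \<in> Hom C A (A \<odot> \<I>)"
    and runit_inv_left: "\<rr>i A \<cdot> \<rr> A = \<one> (A \<odot> \<I>)"
    and runit_inv_right: "\<rr> A \<cdot> \<rr>i A = \<one> A"
    and runit_natural: "f \<in> Hom C A B \<Longrightarrow> \<rr> B \<cdot> (f \<otimes> \<one> \<I>) = f \<cdot> \<rr> A"
    and pentagon: "\<alpha> A B (D \<odot> E) \<cdot> \<alpha> (A \<odot> B) D E =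
      (\<one> A \<otimes> \<alpha> B D E) \<cdot> \<alpha> A (B \<odot> D) E \<cdot> (\<alpha> A B D \<otimes> \<one> E)"
    and triangle: "(\<one> A \<otimes> \<ll> B) \<cdot> \<alpha> A \<I> B = \<rr> A \<otimes> \<one> B"
    and swap_hom: "\<sigma> A B \<in> Hom C (A \<odot> B) (B \<odot> A)"
    and swap_natural: "f \<in> Hom C A A' \<Longrightarrow> g \<in> Hom C B B' \<Longrightarrow>
      \<sigma> A' B' \<cdot> (f \<otimes> g) = (g \<otimes> f) \<cdot> \<sigma> A B"
    and swap_swap: "\<sigma> B A \<cdot> \<sigma> A B = \<one> (A \<odot> B)"
    and swap_unit: "\<ll> A \<cdot> \<sigma> A \<I> = \<rr> A"
    and hexagon: "\<alpha> B D A \<cdot> \<sigma> A (B \<odot> D) \<cdot> \<alpha> A B D =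
      (\<one> B \<otimes> \<sigma> A D) \<cdot> \<alpha> B A D \<cdot> (\<sigma> A B \<otimes> \<one> D)"

definition middle_swap :: "('o, 'm, 'z) smc_data_scheme \<Rightarrow> 'o \<Rightarrow> 'o \<Rightarrow> 'o \<Rightarrow> 'o \<Rightarrow> 'm"
  \<comment> \<open>\<open>(A \<otimes> B) \<otimes> (D \<otimes> E) \<rightarrow> (A \<otimes> D) \<otimes> (B \<otimes> E)\<close>\<close>
  where "middle_swap C A B D E =
    assoc_inv C A D (tens_obj C B E) \<cdot>\<^bsub>C\<^esub>
    (ident C A \<otimes>\<^bsub>C\<^esub>
      (assoc C D B E \<cdot>\<^bsub>C\<^esub> (swap C B D \<otimes>\<^bsub>C\<^esub> ident C E) \<cdot>\<^bsub>C\<^esub> assoc_inv C B D E)) \<cdot>\<^bsub>C\<^esub>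
    assoc C A B (tens_obj C D E)"


section \<open>Markov categories\<close>

record ('o, 'm) markov_data = "('o, 'm) smc_data" +
  Copy :: "'o \<Rightarrow> 'm" ("copy\<index>")
  Del :: "'o \<Rightarrow> 'm" ("del\<index>")

text \<open>
  Since the unit is terminal, the compatibility of \<open>del\<close> with the tensor product and the
  comonoid structure of the unit follow from the axioms below.
\<close>

locale markov_category = symmetric_monoidal_category C
  for C :: "('o, 'm, 'z) markov_data_scheme" (structure) +
  assumes copy_hom: "copy A \<in> Hom C A (A \<odot> A)"
    and del_hom: "del A \<in> Hom C A \<I>"
    and unit_terminal: "f \<in> Hom C A \<I> \<Longrightarrow> f = del A"
    and copy_assoc: "\<alpha> A A A \<cdot> (copy A \<otimes> \<one> A) \<cdot> copy A = (\<one> A \<otimes> copy A) \<cdot> copy A"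
    and copy_counit_left: "\<ll> A \<cdot> (del A \<otimes> \<one> A) \<cdot> copy A = \<one> A"
    and copy_counit_right: "\<rr> A \<cdot> (\<one> A \<otimes> del A) \<cdot> copy A = \<one> A"
    and copy_commute: "\<sigma> A A \<cdot> copy A = copy A"
    and copy_tens: "copy (A \<odot> B) = middle_swap C A A B B \<cdot> (copy A \<otimes> copy B)"

context
  fixes C :: "('o, 'm, 'z) markov_data_scheme" (structure)
begin

definition drop_right :: "'o \<Rightarrow> 'o \<Rightarrow> 'm" \<comment> \<open>\<open>A \<otimes> B \<rightarrow> A\<close>\<close>
  where "drop_right A B = \<rr> A \<cdot> (\<one> A \<otimes> del B)"

definition drop_left :: "'o \<Rightarrow> 'o \<Rightarrow> 'm" \<comment> \<open>\<open>A \<otimes> B \<rightarrow> B\<close>\<close>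
  where "drop_left A B = \<ll> B \<cdot> (del A \<otimes> \<one> B)"

text \<open>\<open>c : A \<otimes> Y \<rightarrow> X\<close> is a conditional of \<open>f : A \<rightarrow> X \<otimes> Y\<close> with respect to \<open>Y\<close>.\<close>

definition is_conditional :: "'o \<Rightarrow> 'o \<Rightarrow> 'o \<Rightarrow> 'm \<Rightarrow> 'm \<Rightarrow> bool" where
  "is_conditional A X Y f c \<longleftrightarrow>
     c \<in> Hom C (A \<odot> Y) X \<and>
     f = (c \<otimes> \<one> Y) \<cdot> \<alpha>i A Y Y \<cdot> (\<one> A \<otimes> copy Y) \<cdot> (\<one> A \<otimes> (drop_left X Y \<cdot> f)) \<cdot> copy A"

definition has_conditionals :: bool where
  "has_conditionals \<longleftrightarrow> (\<forall>A X Y. \<forall>f \<in> Hom C A (X \<odot> Y). \<exists>c. is_conditional A X Y f c)"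

text \<open>Equality of \<open>a\<close> and \<open>b\<close> (with common source \<open>A\<close>) \<open>q\<close>-almost surely, for \<open>q\<close> with target \<open>A\<close>.\<close>

definition as_equal :: "'o \<Rightarrow> 'm \<Rightarrow> 'm \<Rightarrow> 'm \<Rightarrow> bool" where
  "as_equal A q a b \<longleftrightarrow> (\<one> A \<otimes> a) \<cdot> copy A \<cdot> q = (\<one> A \<otimes> b) \<cdot> copy A \<cdot> q"


section \<open>Finite tensor products\<close>

text \<open>
  \<open>tens_objs F k\<close> is \<open>F 0 \<otimes> \<dots> \<otimes> F (k - 1)\<close>, bracketed as
  \<open>((I \<otimes> F 0) \<otimes> F 1) \<otimes> \<dots>\<close>. In particular it is the unit for \<open>k = 0\<close>.
\<close>

primrec tens_objs :: "(nat \<Rightarrow> 'o) \<Rightarrow> nat \<Rightarrow> 'o" where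
  "tens_objs F 0 = \<I>"
| "tens_objs F (Suc k) = tens_objs F k \<odot> F k"

primrec tens_mors :: "(nat \<Rightarrow> 'm) \<Rightarrow> nat \<Rightarrow> 'm" where
  "tens_mors h 0 = \<one> \<I>"
| "tens_mors h (Suc k) = tens_mors h k \<otimes> h k"

text \<open>\<open>upto_objs F t\<close> is \<open>F\<^bsub>[t]\<^esub>\<close> and \<open>after_objs F t n\<close> is \<open>F\<^bsub>(t,n]\<^esub>\<close>.\<close>

definition upto_objs :: "(nat \<Rightarrow> 'o) \<Rightarrow> nat \<Rightarrow> 'o" where
  "upto_objs F t = tens_objs F (Suc t)"

definition after_objs :: "(nat \<Rightarrow> 'o) \<Rightarrow> nat \<Rightarrow> nat \<Rightarrow> 'o" where
  "after_objs F t n = tens_objs (\<lambda>i. F (Suc t + i)) (n - t)"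

text \<open>
  The marginal on the first \<open>k\<close> factors:
  \<open>F 0 \<otimes> \<dots> \<otimes> F (k + j - 1) \<rightarrow> F 0 \<otimes> \<dots> \<otimes> F (k - 1)\<close>.
\<close>

primrec truncate :: "(nat \<Rightarrow> 'o) \<Rightarrow> nat \<Rightarrow> nat \<Rightarrow> 'm" where
  "truncate F k 0 = \<one> (tens_objs F k)"
| "truncate F k (Suc j) = truncate F k j \<cdot> drop_right (tens_objs F (k + j)) (F (k + j))"

text \<open>
  The coherence isomorphism from \<open>F 0 \<otimes> \<dots> \<otimes> F (k + j - 1)\<close> to
  \<open>(F 0 \<otimes> \<dots> \<otimes> F (k - 1)) \<otimes> (F k \<otimes> \<dots> \<otimes> F (k + j - 1))\<close>, and its inverse.
\<close>

primrec tens_split :: "(nat \<Rightarrow> 'o) \<Rightarrow> nat \<Rightarrow> nat \<Rightarrow> 'm" where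
  "tens_split F k 0 = \<rr>i (tens_objs F k)"
| "tens_split F k (Suc j) =
     \<alpha> (tens_objs F k) (tens_objs (\<lambda>i. F (k + i)) j) (F (k + j)) \<cdot>
     (tens_split F k j \<otimes> \<one> (F (k + j)))"

primrec tens_join :: "(nat \<Rightarrow> 'o) \<Rightarrow> nat \<Rightarrow> nat \<Rightarrow> 'm" where
  "tens_join F k 0 = \<rr> (tens_objs F k)"
| "tens_join F k (Suc j) =
     (tens_join F k j \<otimes> \<one> (F (k + j))) \<cdot>
     \<alpha>i (tens_objs F k) (tens_objs (\<lambda>i. F (k + i)) j) (F (k + j))"

text \<open>
  \<open>copy\<^bsub>F[t]\<^esub> \<otimes> id\<^bsub>F(t,n]\<^esub>\<close>, regarded as a morphism
  \<open>F\<^bsub>[n]\<^esub> \<rightarrow> F\<^bsub>[t]\<^esub> \<otimes> F\<^bsub>[n]\<^esub>\<close> for \<open>t \<le> n\<close>.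
\<close>

definition copy_upto :: "(nat \<Rightarrow> 'o) \<Rightarrow> nat \<Rightarrow> nat \<Rightarrow> 'm" where
  "copy_upto F t n =
     (\<one> (upto_objs F t) \<otimes> tens_join F (Suc t) (n - t)) \<cdot>
     \<alpha> (upto_objs F t) (upto_objs F t) (after_objs F t n) \<cdot>
     (copy (upto_objs F t) \<otimes> \<one> (after_objs F t n)) \<cdot>
     tens_split F (Suc t) (n - t)"


section \<open>Hidden Markov models\<close>

definition hmm_kernels ::
    "nat \<Rightarrow> (nat \<Rightarrow> 'o) \<Rightarrow> (nat \<Rightarrow> 'o) \<Rightarrow> (nat \<Rightarrow> 'm) \<Rightarrow> (nat \<Rightarrow> 'm) \<Rightarrow> bool" where
  "hmm_kernels n X Y f g \<longleftrightarrow>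
     f 0 \<in> Hom C \<I> (X 0) \<and>
     (\<forall>t<n. f (Suc t) \<in> Hom C (X t) (X (Suc t))) \<and>
     (\<forall>t\<le>n. g t \<in> Hom C (X t) (Y t))"

text \<open>\<open>hmm_chain X f t\<close> is the state \<open>m\<^sub>t\<close> of \<open>X\<^bsub>[t]\<^esub>\<close>.\<close>

primrec hmm_chain :: "(nat \<Rightarrow> 'o) \<Rightarrow> (nat \<Rightarrow> 'm) \<Rightarrow> nat \<Rightarrow> 'm" where
  "hmm_chain X f 0 = \<ll>i (X 0) \<cdot> f 0"
| "hmm_chain X f (Suc t) =
     \<alpha>i (tens_objs X t) (X t) (X (Suc t)) \<cdot>
     (\<one> (tens_objs X t) \<otimes> ((\<one> (X t) \<otimes> f (Suc t)) \<cdot> copy (X t))) \<cdot>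
     hmm_chain X f t"

definition hmm_state ::
    "nat \<Rightarrow> (nat \<Rightarrow> 'o) \<Rightarrow> (nat \<Rightarrow> 'm) \<Rightarrow> (nat \<Rightarrow> 'm) \<Rightarrow> 'm" where
  "hmm_state n X f g =
     tens_mors (\<lambda>t. (\<one> (X t) \<otimes> g t) \<cdot> copy (X t)) (Suc n) \<cdot> hmm_chain X f n"

text \<open>
  Marginals of a state \<open>p\<close> of \<open>\<Otimes>\<^bsub>t \<in> [n]\<^esub> (X\<^sub>t \<otimes> Y\<^sub>t)\<close>.
  \<open>marginal_Y n X Y s p\<close> is the marginal on \<open>Y\<^bsub>[s]\<^esub>\<close>.
\<close>

definition marginal_Y ::
    "nat \<Rightarrow> (nat \<Rightarrow> 'o) \<Rightarrow> (nat \<Rightarrow> 'o) \<Rightarrow> nat \<Rightarrow> 'm \<Rightarrow> 'm" where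
  "marginal_Y n X Y s p =
     tens_mors (\<lambda>i. drop_left (X i) (Y i)) (Suc s) \<cdot>
     truncate (\<lambda>i. X i \<odot> Y i) (Suc s) (n - s) \<cdot> p"

text \<open>
  \<open>keep_YX X Y t j : \<Otimes>\<^bsub>i \<in> [t+j]\<^esub> (X\<^sub>i \<otimes> Y\<^sub>i) \<rightarrow> Y\<^bsub>[t+j]\<^esub> \<otimes> X\<^sub>t\<close> deletes
  all \<open>X\<^sub>i\<close> with \<open>i \<noteq> t\<close> and moves \<open>X\<^sub>t\<close> to the right end; \<open>marginal_YX n X Y s t p\<close> is the
  marginal on \<open>Y\<^bsub>[s]\<^esub> \<otimes> X\<^sub>t\<close>, for \<open>t \<le> s \<le> n\<close>.
\<close>

primrec keep_YX :: "(nat \<Rightarrow> 'o) \<Rightarrow> (nat \<Rightarrow> 'o) \<Rightarrow> nat \<Rightarrow> nat \<Rightarrow> 'm" where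
  "keep_YX X Y t 0 =
     \<alpha>i (tens_objs Y t) (Y t) (X t) \<cdot>
     (tens_mors (\<lambda>i. drop_left (X i) (Y i)) t \<otimes> \<sigma> (X t) (Y t))"
| "keep_YX X Y t (Suc j) =
     \<alpha>i (upto_objs Y (t + j)) (Y (t + Suc j)) (X t) \<cdot>
     (\<one> (upto_objs Y (t + j)) \<otimes> \<sigma> (X t) (Y (t + Suc j))) \<cdot>
     \<alpha> (upto_objs Y (t + j)) (X t) (Y (t + Suc j)) \<cdot>
     (keep_YX X Y t j \<otimes> drop_left (X (t + Suc j)) (Y (t + Suc j)))"

definition marginal_YX ::
    "nat \<Rightarrow> (nat \<Rightarrow> 'o) \<Rightarrow> (nat \<Rightarrow> 'o) \<Rightarrow> nat \<Rightarrow> nat \<Rightarrow> 'm \<Rightarrow> 'm" where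
  "marginal_YX n X Y s t p =
     keep_YX X Y t (s - t) \<cdot> truncate (\<lambda>i. X i \<odot> Y i) (Suc s) (n - s) \<cdot> p"

text \<open>
  \<open>b : Y\<^bsub>[s]\<^esub> \<rightarrow> X\<^sub>t\<close> is a conditional with respect to \<open>Y\<^bsub>[s]\<^esub>\<close> of the marginal on
  \<open>Y\<^bsub>[s]\<^esub> \<otimes> X\<^sub>t\<close>. The swap moves the conditioning object to the right, and \<open>\<ll>\<close> absorbs the
  source \<open>I\<close> of a state.
\<close>

definition posterior ::
    "nat \<Rightarrow> (nat \<Rightarrow> 'o) \<Rightarrow> (nat \<Rightarrow> 'o) \<Rightarrow> 'm \<Rightarrow> nat \<Rightarrow> nat \<Rightarrow> 'm \<Rightarrow> bool" where
  "posterior n X Y p s t b \<longleftrightarrow>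
     b \<in> Hom C (upto_objs Y s) (X t) \<and>
     is_conditional \<I> (X t) (upto_objs Y s)
       (\<sigma> (upto_objs Y s) (X t) \<cdot> marginal_YX n X Y s t p)
       (b \<cdot> \<ll> (upto_objs Y s))"

definition bayes_filter ::
    "nat \<Rightarrow> (nat \<Rightarrow> 'o) \<Rightarrow> (nat \<Rightarrow> 'o) \<Rightarrow> 'm \<Rightarrow> nat \<Rightarrow> 'm \<Rightarrow> bool" where
  "bayes_filter n X Y p t b \<longleftrightarrow> posterior n X Y p t t b"

definition bayes_smoother ::
    "nat \<Rightarrow> (nat \<Rightarrow> 'o) \<Rightarrow> (nat \<Rightarrow> 'o) \<Rightarrow> 'm \<Rightarrow> nat \<Rightarrow> 'm \<Rightarrow> bool" where
  "bayes_smoother n X Y p t b \<longleftrightarrow> posterior n X Y p n t b"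

end

end

theory Submission
  imports Defs
begin

text \<open>
  Write \<open>\<langle>a, b\<rangle>\<close> for \<open>(a \<otimes> b) \<circ> copy\<close>. In a Markov category the two marginals of \<open>\<langle>a, b\<rangle>\<close> are \<open>a\<close>
  and \<open>b\<close>, and all coherence isomorphisms are deterministic and built from projections by pairing,
  so the explicit bracketing disappears from equations between pairings. A pairing may however
  be distributed over a precomposed morphism only if that morphism is deterministic.

  By the Markov property, the joint state of \<open>Y\<^bsub>[n]\<^esub>, X\<^sub>t, X\<^bsub>t+1\<^esub>\<close> is obtained from the state \<open>J\<close> of
  \<open>Y\<^bsub>[t]\<^esub>, X\<^sub>t, X\<^bsub>t+1\<^esub>\<close> by applying a kernel \<open>h: X\<^bsub>t+1\<^esub> \<rightarrow> Y\<^bsub>(t,n]\<^esub>\<close>. The filter and the definition of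
  \<open>k\<^sub>t\<close> show that \<open>J\<close> is its marginal on \<open>Y\<^bsub>[t]\<^esub>, X\<^bsub>t+1\<^esub>\<close> followed by \<open>k\<^sub>t\<close>. Since \<open>h\<close> does not look at
  \<open>X\<^sub>t\<close>, the two extensions commute: \<open>k\<^sub>t\<close> also conditions \<open>X\<^sub>t\<close> on \<open>Y\<^bsub>[n]\<^esub>, X\<^bsub>t+1\<^esub>\<close>, and \<open>BS\<^bsub>t+1\<^esub>\<close> supplies
  \<open>X\<^bsub>t+1\<^esub>\<close> given \<open>Y\<^bsub>[n]\<^esub>\<close>.
\<close>

section \<open>Coherence\<close>

context category
begin

lemma Src_ident [simp]: "Src C (\<one> A) = A" and Tgt_ident [simp]: "Tgt C (\<one> A) = A"
  using ident_hom[of A] by (auto simp: Hom_def)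

lemma Src_comp [simp]: "Tgt C f = Src C g \<Longrightarrow> Src C (g \<cdot> f) = Src C f"
  and Tgt_comp [simp]: "Tgt C f = Src C g \<Longrightarrow> Tgt C (g \<cdot> f) = Tgt C g"
  using comp_hom[of f "Src C f" "Tgt C f" g "Tgt C g"] by (auto simp: Hom_def)

lemma ident_comp [simp]: "Tgt C f = B \<Longrightarrow> \<one> B \<cdot> f = f"
  using comp_ident_left[of f "Src C f" B] by (auto simp: Hom_def)

lemma comp_ident [simp]: "Src C f = A \<Longrightarrow> f \<cdot> \<one> A = f"
  using comp_ident_right[of f A "Tgt C f"] by (auto simp: Hom_def)

lemma comp_assoc' [simp]:
  "Tgt C f = Src C g \<Longrightarrow> Tgt C g = Src C h \<Longrightarrow> (h \<cdot> g) \<cdot> f = h \<cdot> g \<cdot> f"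
  using comp_assoc[of f "Src C f" "Tgt C f" g "Tgt C g" h "Tgt C h"] by (auto simp: Hom_def)

text \<open>Compositions are normalised to the right, so an equation for \<open>a \<cdot> b\<close>
  does not match inside \<open>a \<cdot> b \<cdot> x\<close>; this lifts it to that
  position.\<close>

lemma comp_tail:
  "a \<cdot> b = c \<Longrightarrow> Tgt C b = Src C a \<Longrightarrow> Tgt C x = Src C b \<Longrightarrow> a \<cdot> b \<cdot> x = c \<cdot> x"
  using comp_assoc'[of x b a] by simp

text \<open>A morphism with a right inverse is epic: precompose both sides with
  \<open>y\<close>.\<close>

lemma cancel_right:
  assumes "u \<cdot> x = v \<cdot> x" "x \<cdot> y = \<one> B" "Tgt C y = Src C x" "Tgt C x = B" "Src C u = B" "Src C v = B"
  shows "u = v"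
  using assms comp_assoc'[of y x u] comp_assoc'[of y x v] by (metis comp_ident)

end

section \<open>Naturality and unit coherence in a symmetric monoidal category\<close>

context symmetric_monoidal_category
begin

lemma Src_tens [simp]: "Src C (f \<otimes> g) = Src C f \<odot> Src C g"
  and Tgt_tens [simp]: "Tgt C (f \<otimes> g) = Tgt C f \<odot> Tgt C g"
  using tens_hom[of f "Src C f" "Tgt C f" g "Src C g" "Tgt C g"] by (auto simp: Hom_def)

lemma Src_coherence [simp]:
  "Src C (\<alpha> A B D) = (A \<odot> B) \<odot> D" "Src C (\<alpha>i A B D) = A \<odot> (B \<odot> D)"
  "Src C (\<ll> A) = \<I> \<odot> A" "Src C (\<ll>i A) = A" "Src C (\<rr> A) = A \<odot> \<I>" "Src C (\<rr>i A) = A"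
  "Src C (\<sigma> A B) = A \<odot> B"
  and Tgt_coherence [simp]:
  "Tgt C (\<alpha> A B D) = A \<odot> (B \<odot> D)" "Tgt C (\<alpha>i A B D) = (A \<odot> B) \<odot> D"
  "Tgt C (\<ll> A) = A" "Tgt C (\<ll>i A) = \<I> \<odot> A" "Tgt C (\<rr> A) = A" "Tgt C (\<rr>i A) = A \<odot> \<I>"
  "Tgt C (\<sigma> A B) = B \<odot> A"
  using assoc_hom[of A B D] assoc_inv_hom[of A B D] lunit_hom[of A] lunit_inv_hom[of A]
    runit_hom[of A] runit_inv_hom[of A] swap_hom[of A B]
  by (auto simp: Hom_def)

lemma tens_comp:
  "Tgt C f = Src C g \<Longrightarrow> Tgt C f' = Src C g' \<Longrightarrow> (g \<otimes> g') \<cdot> (f \<otimes> f') = (g \<cdot> f) \<otimes> (g' \<cdot> f')"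
  using interchange[of f "Src C f" "Tgt C f" g "Tgt C g" f' "Src C f'" "Tgt C f'" g' "Tgt C g'"]
  by (auto simp: Hom_def)

lemma tens_comp_tail:
  assumes "Tgt C f = Src C g" "Tgt C f' = Src C g'" "Tgt C x = Src C f \<odot> Src C f'"
  shows "(g \<otimes> g') \<cdot> (f \<otimes> f') \<cdot> x = ((g \<cdot> f) \<otimes> (g' \<cdot> f')) \<cdot> x"
  using assms by (intro comp_tail tens_comp) auto

lemma assoc_natural':
  "\<alpha> (Tgt C f) (Tgt C g) (Tgt C h) \<cdot> ((f \<otimes> g) \<otimes> h) = (f \<otimes> (g \<otimes> h)) \<cdot> \<alpha> (Src C f) (Src C g) (Src C h)"
  by (rule assoc_natural) (auto simp: Hom_def)

lemma assoc_inv_natural':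
  "\<alpha>i (Tgt C f) (Tgt C g) (Tgt C h) \<cdot> (f \<otimes> (g \<otimes> h)) = ((f \<otimes> g) \<otimes> h) \<cdot> \<alpha>i (Src C f) (Src C g) (Src C h)"
  (is "?L = ?R")
proof (rule cancel_right[OF _ assoc_inv_right])
  show "?L \<cdot> \<alpha> (Src C f) (Src C g) (Src C h) = ?R \<cdot> \<alpha> (Src C f) (Src C g) (Src C h)"
    by (simp add: assoc_natural'[symmetric] assoc_inv_left comp_tail[OF assoc_inv_left])
qed auto

lemma lunit_natural': "\<ll> (Tgt C f) \<cdot> (\<one> \<I> \<otimes> f) = f \<cdot> \<ll> (Src C f)"
  by (rule lunit_natural) (auto simp: Hom_def)

lemma runit_natural': "\<rr> (Tgt C f) \<cdot> (f \<otimes> \<one> \<I>) = f \<cdot> \<rr> (Src C f)"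
  by (rule runit_natural) (auto simp: Hom_def)

lemma swap_natural':
  "\<sigma> (Tgt C f) (Tgt C g) \<cdot> (f \<otimes> g) = (g \<otimes> f) \<cdot> \<sigma> (Src C f) (Src C g)"
  by (rule swap_natural) (auto simp: Hom_def)

text \<open>Tensoring with the unit is faithful, because naturality of the unitor recovers
  \<open>u\<close> from \<open>\<one> \<I> \<otimes> u\<close> up to invertible maps.\<close>

lemma unit_tens_cancel:
  assumes "\<one> \<I> \<otimes> u = \<one> \<I> \<otimes> v" "Src C u = Src C v" "Tgt C u = Tgt C v"
  shows "u = v"
proof (rule cancel_right[of _ "\<ll> (Src C u)" _ "\<ll>i (Src C u)"])
  show "u \<cdot> \<ll> (Src C u) = v \<cdot> \<ll> (Src C u)"
    using lunit_natural'[of u] lunit_natural'[of v] assms by simp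
qed (use assms in \<open>auto simp: lunit_inv_right\<close>)

lemma tens_unit_cancel:
  assumes "u \<otimes> \<one> \<I> = v \<otimes> \<one> \<I>" "Src C u = Src C v" "Tgt C u = Tgt C v"
  shows "u = v"
proof (rule cancel_right[of _ "\<rr> (Src C u)" _ "\<rr>i (Src C u)"])
  show "u \<cdot> \<rr> (Src C u) = v \<cdot> \<rr> (Src C u)"
    using runit_natural'[of u] runit_natural'[of v] assms by simp
qed (use assms in \<open>auto simp: runit_inv_right\<close>)

text \<open>The next two lemmas are Kelly's: the remaining unit triangles follow from the pentagon.\<close>

lemma lunit_tens: "\<ll> (A \<odot> B) \<cdot> \<alpha> \<I> A B = \<ll> A \<otimes> \<one> B"
proof (rule unit_tens_cancel, rule cancel_right)
  \<comment> \<open>The pentagon and the triangle apply only after tensoring with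
    \<open>\<I>\<close> on the left and precomposing with \<open>?X\<close>; the right inverse
    \<open>?Y\<close> allows \<open>?X\<close> to be cancelled.\<close>
  let ?X = "\<alpha> \<I> (\<I> \<odot> A) B \<cdot> (\<alpha> \<I> \<I> A \<otimes> \<one> B)"
  let ?Y = "(\<alpha>i \<I> \<I> A \<otimes> \<one> B) \<cdot> \<alpha>i \<I> (\<I> \<odot> A) B"
  have "(\<one> \<I> \<otimes> (\<ll> (A \<odot> B) \<cdot> \<alpha> \<I> A B)) \<cdot> ?X
      = (\<one> \<I> \<otimes> \<ll> (A \<odot> B)) \<cdot> (\<one> \<I> \<otimes> \<alpha> \<I> A B) \<cdot> ?X"
    by (simp add: tens_comp_tail)
  also have "\<dots> = (\<one> \<I> \<otimes> \<ll> (A \<odot> B)) \<cdot> \<alpha> \<I> \<I> (A \<odot> B) \<cdot> \<alpha> (\<I> \<odot> \<I>) A B"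
    by (simp add: pentagon)
  also have "\<dots> = (\<rr> \<I> \<otimes> (\<one> A \<otimes> \<one> B)) \<cdot> \<alpha> (\<I> \<odot> \<I>) A B"
    by (simp add: comp_tail[OF triangle] tens_ident)
  also have "\<dots> = \<alpha> \<I> A B \<cdot> ((\<rr> \<I> \<otimes> \<one> A) \<otimes> \<one> B)"
    using assoc_natural'[of "\<rr> \<I>" "\<one> A" "\<one> B"] by simp
  also have "\<dots> = \<alpha> \<I> A B \<cdot> ((\<one> \<I> \<otimes> \<ll> A) \<otimes> \<one> B) \<cdot> (\<alpha> \<I> \<I> A \<otimes> \<one> B)"
    by (simp add: tens_comp triangle)
  also have "\<dots> = (\<one> \<I> \<otimes> (\<ll> A \<otimes> \<one> B)) \<cdot> ?X"
    using comp_tail[OF assoc_natural'[of "\<one> \<I>" "\<ll> A" "\<one> B"], of "\<alpha> \<I> \<I> A \<otimes> \<one> B"] by simp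
  finally show "(\<one> \<I> \<otimes> (\<ll> (A \<odot> B) \<cdot> \<alpha> \<I> A B)) \<cdot> ?X = (\<one> \<I> \<otimes> (\<ll> A \<otimes> \<one> B)) \<cdot> ?X" .
  show "?X \<cdot> ?Y = \<one> (\<I> \<odot> ((\<I> \<odot> A) \<odot> B))"
    by (simp add: tens_comp_tail assoc_inv_right tens_ident)
qed auto

lemma runit_tens: "(\<one> A \<otimes> \<rr> B) \<cdot> \<alpha> A B \<I> = \<rr> (A \<odot> B)"
proof (rule tens_unit_cancel)
  \<comment> \<open>The equation is tested after tensoring with \<open>\<I>\<close> on the right.
    The associator put in front makes the pentagon applicable and is cancelled at the end.\<close>
  have "\<alpha> A B \<I> \<cdot> (((\<one> A \<otimes> \<rr> B) \<cdot> \<alpha> A B \<I>) \<otimes> \<one> \<I>)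
      = \<alpha> A B \<I> \<cdot> ((\<one> A \<otimes> \<rr> B) \<otimes> \<one> \<I>) \<cdot> (\<alpha> A B \<I> \<otimes> \<one> \<I>)"
    by (simp add: tens_comp)
  also have "\<dots> = (\<one> A \<otimes> (\<rr> B \<otimes> \<one> \<I>)) \<cdot> \<alpha> A (B \<odot> \<I>) \<I> \<cdot> (\<alpha> A B \<I> \<otimes> \<one> \<I>)"
    using comp_tail[OF assoc_natural'[of "\<one> A" "\<rr> B" "\<one> \<I>"], of "\<alpha> A B \<I> \<otimes> \<one> \<I>"] by simp
  also have "\<dots> = (\<one> A \<otimes> (\<one> B \<otimes> \<ll> \<I>)) \<cdot> (\<one> A \<otimes> \<alpha> B \<I> \<I>) \<cdot> \<alpha> A (B \<odot> \<I>) \<I> \<cdot> (\<alpha> A B \<I> \<otimes> \<one> \<I>)"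
    by (simp add: tens_comp_tail triangle)
  also have "\<dots> = (\<one> A \<otimes> (\<one> B \<otimes> \<ll> \<I>)) \<cdot> \<alpha> A B (\<I> \<odot> \<I>) \<cdot> \<alpha> (A \<odot> B) \<I> \<I>"
    by (simp add: pentagon)
  also have "\<dots> = \<alpha> A B \<I> \<cdot> ((\<one> A \<otimes> \<one> B) \<otimes> \<ll> \<I>) \<cdot> \<alpha> (A \<odot> B) \<I> \<I>"
    using comp_tail[OF assoc_natural'[of "\<one> A" "\<one> B" "\<ll> \<I>"], of "\<alpha> (A \<odot> B) \<I> \<I>"] by simp
  also have "\<dots> = \<alpha> A B \<I> \<cdot> (\<rr> (A \<odot> B) \<otimes> \<one> \<I>)"
    by (simp add: tens_ident triangle)
  finally have *: "\<alpha> A B \<I> \<cdot> (((\<one> A \<otimes> \<rr> B) \<cdot> \<alpha> A B \<I>) \<otimes> \<one> \<I>) = \<alpha> A B \<I> \<cdot> (\<rr> (A \<odot> B) \<otimes> \<one> \<I>)" .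
  show "((\<one> A \<otimes> \<rr> B) \<cdot> \<alpha> A B \<I>) \<otimes> \<one> \<I> = \<rr> (A \<odot> B) \<otimes> \<one> \<I>"
    using arg_cong[OF *, of "\<lambda>x. \<alpha>i A B \<I> \<cdot> x"] by (simp add: comp_tail[OF assoc_inv_left])
qed auto

section \<open>The middle swap and its reduction at unit factors\<close>

lemma Src_middle_swap [simp]: "Src C (middle_swap C A B D E) = (A \<odot> B) \<odot> (D \<odot> E)"
  and Tgt_middle_swap [simp]: "Tgt C (middle_swap C A B D E) = (A \<odot> D) \<odot> (B \<odot> E)"
  by (simp_all add: middle_swap_def)

lemma middle_swap_natural:
  "middle_swap C (Tgt C a) (Tgt C b) (Tgt C d) (Tgt C e) \<cdot> ((a \<otimes> b) \<otimes> (d \<otimes> e))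
    = ((a \<otimes> d) \<otimes> (b \<otimes> e)) \<cdot> middle_swap C (Src C a) (Src C b) (Src C d) (Src C e)"
proof -
  let ?T = "\<lambda>b d e. \<alpha> d b e \<cdot> (\<sigma> b d \<otimes> \<one> e) \<cdot> \<alpha>i b d e"
  have 1: "?T (Tgt C b) (Tgt C d) (Tgt C e) \<cdot> (b \<otimes> (d \<otimes> e)) = (d \<otimes> (b \<otimes> e)) \<cdot> ?T (Src C b) (Src C d) (Src C e)"
    (is "?t1 \<cdot> _ = _ \<cdot> ?t2")
  proof -
    have "?T (Tgt C b) (Tgt C d) (Tgt C e) \<cdot> (b \<otimes> (d \<otimes> e))
        = \<alpha> (Tgt C d) (Tgt C b) (Tgt C e) \<cdot> (\<sigma> (Tgt C b) (Tgt C d) \<otimes> \<one> (Tgt C e)) \<cdot> ((b \<otimes> d) \<otimes> e) \<cdot> \<alpha>i (Src C b) (Src C d) (Src C e)"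
      by (simp add: assoc_inv_natural')
    also have "\<dots> = \<alpha> (Tgt C d) (Tgt C b) (Tgt C e) \<cdot> ((d \<otimes> b) \<otimes> e) \<cdot> (\<sigma> (Src C b) (Src C d) \<otimes> \<one> (Src C e)) \<cdot> \<alpha>i (Src C b) (Src C d) (Src C e)"
      by (simp add: tens_comp_tail swap_natural')
    also have "\<dots> = (d \<otimes> (b \<otimes> e)) \<cdot> ?T (Src C b) (Src C d) (Src C e)"
      by (simp add: comp_tail[OF assoc_natural'])
    finally show ?thesis .
  qed
  have "middle_swap C (Tgt C a) (Tgt C b) (Tgt C d) (Tgt C e) \<cdot> ((a \<otimes> b) \<otimes> (d \<otimes> e))
      = \<alpha>i (Tgt C a) (Tgt C d) (Tgt C b \<odot> Tgt C e) \<cdot> (\<one> (Tgt C a) \<otimes> ?t1) \<cdot> \<alpha> (Tgt C a) (Tgt C b) (Tgt C d \<odot> Tgt C e) \<cdot> ((a \<otimes> b) \<otimes> (d \<otimes> e))"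
    by (simp add: middle_swap_def)
  also have "\<dots> = \<alpha>i (Tgt C a) (Tgt C d) (Tgt C b \<odot> Tgt C e) \<cdot> (\<one> (Tgt C a) \<otimes> ?t1) \<cdot> (a \<otimes> (b \<otimes> (d \<otimes> e))) \<cdot> \<alpha> (Src C a) (Src C b) (Src C d \<odot> Src C e)"
    using assoc_natural'[of a b "d \<otimes> e"] by simp
  also have "\<dots> = \<alpha>i (Tgt C a) (Tgt C d) (Tgt C b \<odot> Tgt C e) \<cdot> (a \<otimes> (?t1 \<cdot> (b \<otimes> (d \<otimes> e)))) \<cdot> \<alpha> (Src C a) (Src C b) (Src C d \<odot> Src C e)"
    by (simp add: tens_comp_tail)
  also have "\<dots> = \<alpha>i (Tgt C a) (Tgt C d) (Tgt C b \<odot> Tgt C e) \<cdot> (a \<otimes> (d \<otimes> (b \<otimes> e))) \<cdot> (\<one> (Src C a) \<otimes> ?t2) \<cdot> \<alpha> (Src C a) (Src C b) (Src C d \<odot> Src C e)"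
    unfolding 1 by (simp add: tens_comp_tail)
  also have "\<dots> = ((a \<otimes> d) \<otimes> (b \<otimes> e)) \<cdot> middle_swap C (Src C a) (Src C b) (Src C d) (Src C e)"
    using comp_tail[OF assoc_inv_natural'[of a d "b \<otimes> e"]] by (simp add: middle_swap_def)
  finally show ?thesis .
qed

lemma runit_swap: "\<rr> A \<cdot> \<sigma> \<I> A = \<ll> A"
  using comp_tail[OF swap_unit[of A], of "\<sigma> \<I> A"] by (simp add: swap_swap)

lemma triangle_inv: "(\<rr> A \<otimes> \<one> B) \<cdot> \<alpha>i A \<I> B = \<one> A \<otimes> \<ll> B"
  by (simp add: triangle[symmetric] assoc_inv_right)

lemma lunit_tens_inv: "(\<ll> A \<otimes> \<one> B) \<cdot> \<alpha>i \<I> A B = \<ll> (A \<odot> B)"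
  by (simp add: lunit_tens[symmetric] assoc_inv_right)

text \<open>The symmetry with the unit is a composite of unitors, so this middle swap is one too. It
  is what remains of copying a product once its second factor has been deleted from both
  copies.\<close>

lemma runit_middle_swap:
  "(\<rr> A \<otimes> \<rr> B) \<cdot> middle_swap C A B \<I> \<I> = \<rr> (A \<odot> B) \<cdot> (\<one> (A \<odot> B) \<otimes> \<ll> \<I>)"
proof -
  let ?T = "\<alpha> \<I> B \<I> \<cdot> (\<sigma> B \<I> \<otimes> \<one> \<I>) \<cdot> \<alpha>i B \<I> \<I>"
  have 1: "(\<rr> A \<otimes> \<rr> B) \<cdot> \<alpha>i A \<I> (B \<odot> \<I>) = \<one> A \<otimes> (\<ll> B \<cdot> (\<one> \<I> \<otimes> \<rr> B))"
  proof -
    have "(\<rr> A \<otimes> \<rr> B) \<cdot> \<alpha>i A \<I> (B \<odot> \<I>)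
        = (\<rr> A \<otimes> \<one> B) \<cdot> ((\<one> A \<otimes> \<one> \<I>) \<otimes> \<rr> B) \<cdot> \<alpha>i A \<I> (B \<odot> \<I>)"
      by (simp add: tens_comp_tail tens_ident)
    also have "\<dots> = (\<rr> A \<otimes> \<one> B) \<cdot> \<alpha>i A \<I> B \<cdot> (\<one> A \<otimes> (\<one> \<I> \<otimes> \<rr> B))"
      using assoc_inv_natural'[of "\<one> A" "\<one> \<I>" "\<rr> B"] by simp
    also have "\<dots> = \<one> A \<otimes> (\<ll> B \<cdot> (\<one> \<I> \<otimes> \<rr> B))"
      by (simp add: comp_tail[OF triangle_inv] tens_comp)
    finally show ?thesis .
  qed
  have 2: "\<ll> B \<cdot> (\<one> \<I> \<otimes> \<rr> B) \<cdot> ?T = \<rr> B \<cdot> (\<one> B \<otimes> \<ll> \<I>)"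
  proof -
    have "\<ll> B \<cdot> (\<one> \<I> \<otimes> \<rr> B) \<cdot> ?T = \<rr> B \<cdot> \<ll> (B \<odot> \<I>) \<cdot> ?T"
      using comp_tail[OF lunit_natural'[of "\<rr> B"], of ?T] by simp
    also have "\<dots> = \<rr> B \<cdot> (\<rr> B \<otimes> \<one> \<I>) \<cdot> \<alpha>i B \<I> \<I>"
      by (simp add: comp_tail[OF lunit_tens] tens_comp_tail swap_unit)
    finally show ?thesis by (simp add: triangle_inv)
  qed
  have "(\<rr> A \<otimes> \<rr> B) \<cdot> middle_swap C A B \<I> \<I>
      = (\<one> A \<otimes> (\<ll> B \<cdot> (\<one> \<I> \<otimes> \<rr> B) \<cdot> ?T)) \<cdot> \<alpha> A B (\<I> \<odot> \<I>)"
    by (simp add: middle_swap_def comp_tail[OF 1] tens_comp_tail)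
  also have "\<dots> = (\<one> A \<otimes> \<rr> B) \<cdot> (\<one> A \<otimes> (\<one> B \<otimes> \<ll> \<I>)) \<cdot> \<alpha> A B (\<I> \<odot> \<I>)"
    unfolding 2 by (simp add: tens_comp_tail)
  also have "\<dots> = (\<one> A \<otimes> \<rr> B) \<cdot> \<alpha> A B \<I> \<cdot> (\<one> (A \<odot> B) \<otimes> \<ll> \<I>)"
    using assoc_natural'[of "\<one> A" "\<one> B" "\<ll> \<I>"] by (simp add: tens_ident)
  also have "\<dots> = \<rr> (A \<odot> B) \<cdot> (\<one> (A \<odot> B) \<otimes> \<ll> \<I>)"
    by (simp add: comp_tail[OF runit_tens])
  finally show ?thesis .
qed

text \<open>The mirror image, for a product whose first factor has been deleted from both
  copies.\<close>

lemma lunit_middle_swap: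
  "(\<ll> A \<otimes> \<ll> B) \<cdot> middle_swap C \<I> \<I> A B = \<ll> (A \<odot> B) \<cdot> (\<rr> \<I> \<otimes> \<one> (A \<odot> B))"
proof -
  let ?T = "\<alpha> A \<I> B \<cdot> (\<sigma> \<I> A \<otimes> \<one> B) \<cdot> \<alpha>i \<I> A B"
  have 1: "(\<ll> A \<otimes> \<ll> B) \<cdot> \<alpha>i \<I> A (\<I> \<odot> B) = \<ll> (A \<odot> B) \<cdot> (\<one> \<I> \<otimes> (\<one> A \<otimes> \<ll> B))"
  proof -
    have "(\<ll> A \<otimes> \<ll> B) \<cdot> \<alpha>i \<I> A (\<I> \<odot> B)
        = (\<ll> A \<otimes> \<one> B) \<cdot> ((\<one> \<I> \<otimes> \<one> A) \<otimes> \<ll> B) \<cdot> \<alpha>i \<I> A (\<I> \<odot> B)"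
      by (simp add: tens_comp_tail tens_ident)
    also have "\<dots> = (\<ll> A \<otimes> \<one> B) \<cdot> \<alpha>i \<I> A B \<cdot> (\<one> \<I> \<otimes> (\<one> A \<otimes> \<ll> B))"
      using assoc_inv_natural'[of "\<one> \<I>" "\<one> A" "\<ll> B"] by simp
    also have "\<dots> = \<ll> (A \<odot> B) \<cdot> (\<one> \<I> \<otimes> (\<one> A \<otimes> \<ll> B))"
      by (simp add: comp_tail[OF lunit_tens_inv])
    finally show ?thesis .
  qed
  have 2: "(\<one> A \<otimes> \<ll> B) \<cdot> ?T = \<ll> (A \<odot> B)"
    by (simp add: comp_tail[OF triangle] tens_comp_tail runit_swap lunit_tens_inv)
  have "(\<ll> A \<otimes> \<ll> B) \<cdot> middle_swap C \<I> \<I> A B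
      = \<ll> (A \<odot> B) \<cdot> (\<one> \<I> \<otimes> ((\<one> A \<otimes> \<ll> B) \<cdot> ?T)) \<cdot> \<alpha> \<I> \<I> (A \<odot> B)"
    by (simp add: middle_swap_def comp_tail[OF 1] tens_comp_tail)
  also have "\<dots> = \<ll> (A \<odot> B) \<cdot> (\<rr> \<I> \<otimes> \<one> (A \<odot> B))"
    unfolding 2 by (simp add: triangle)
  finally show ?thesis .
qed

end

section \<open>Pairings and deterministic morphisms\<close>

context markov_category
begin

lemma Src_copy [simp]: "Src C (copy A) = A" and Tgt_copy [simp]: "Tgt C (copy A) = A \<odot> A"
  and Src_del [simp]: "Src C (del A) = A" and Tgt_del [simp]: "Tgt C (del A) = \<I>"
  using copy_hom[of A] del_hom[of A] by (auto simp: Hom_def)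

lemma into_unit_eq: "Tgt C f = \<I> \<Longrightarrow> Tgt C g = \<I> \<Longrightarrow> Src C f = Src C g \<Longrightarrow> f = g"
  using unit_terminal[of f "Src C f"] unit_terminal[of g "Src C f"] by (simp add: Hom_def)

lemma del_unit [simp]: "del \<I> = \<one> \<I>"
  by (rule into_unit_eq) auto

lemma del_comp [simp]: "Tgt C f = A \<Longrightarrow> del A \<cdot> f = del (Src C f)"
  by (rule into_unit_eq) auto

abbreviation \<pi>\<^sub>1 :: "'o \<Rightarrow> 'o \<Rightarrow> 'm" where "\<pi>\<^sub>1 \<equiv> drop_right C"
abbreviation \<pi>\<^sub>2 :: "'o \<Rightarrow> 'o \<Rightarrow> 'm" where "\<pi>\<^sub>2 \<equiv> drop_left C"

lemma Src_proj [simp]: "Src C (\<pi>\<^sub>1 A B) = A \<odot> B" "Src C (\<pi>\<^sub>2 A B) = A \<odot> B"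
  and Tgt_proj [simp]: "Tgt C (\<pi>\<^sub>1 A B) = A" "Tgt C (\<pi>\<^sub>2 A B) = B"
  by (simp_all add: drop_right_def drop_left_def)

definition pair :: "'m \<Rightarrow> 'm \<Rightarrow> 'm"  ("\<langle>_,/ _\<rangle>") where
  "\<langle>a, b\<rangle> = (a \<otimes> b) \<cdot> copy (Src C a)"

definition det :: "'m \<Rightarrow> bool" where
  "det f \<longleftrightarrow> copy (Tgt C f) \<cdot> f = (f \<otimes> f) \<cdot> copy (Src C f)"

lemma Src_pair [simp]: "Src C a = Src C b \<Longrightarrow> Src C \<langle>a, b\<rangle> = Src C b"
  and Tgt_pair [simp]: "Src C a = Src C b \<Longrightarrow> Tgt C \<langle>a, b\<rangle> = Tgt C a \<odot> Tgt C b"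
  by (simp_all add: pair_def)

lemma fst_tens: "Tgt C u = A \<Longrightarrow> Tgt C v = B \<Longrightarrow> \<pi>\<^sub>1 A B \<cdot> (u \<otimes> v) = u \<cdot> \<pi>\<^sub>1 (Src C u) (Src C v)"
proof -
  assume [simp]: "Tgt C u = A" "Tgt C v = B"
  have "\<pi>\<^sub>1 A B \<cdot> (u \<otimes> v) = \<rr> A \<cdot> (u \<otimes> \<one> \<I>) \<cdot> (\<one> (Src C u) \<otimes> del (Src C v))"
    by (simp add: drop_right_def tens_comp)
  also have "\<dots> = u \<cdot> \<pi>\<^sub>1 (Src C u) (Src C v)"
    using comp_tail[OF runit_natural'[of u], of "\<one> (Src C u) \<otimes> del (Src C v)"]
    by (simp add: drop_right_def)
  finally show ?thesis .
qed

lemma snd_tens: "Tgt C u = A \<Longrightarrow> Tgt C v = B \<Longrightarrow> \<pi>\<^sub>2 A B \<cdot> (u \<otimes> v) = v \<cdot> \<pi>\<^sub>2 (Src C u) (Src C v)"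
proof -
  assume [simp]: "Tgt C u = A" "Tgt C v = B"
  have "\<pi>\<^sub>2 A B \<cdot> (u \<otimes> v) = \<ll> B \<cdot> (\<one> \<I> \<otimes> v) \<cdot> (del (Src C u) \<otimes> \<one> (Src C v))"
    by (simp add: drop_left_def tens_comp)
  also have "\<dots> = v \<cdot> \<pi>\<^sub>2 (Src C u) (Src C v)"
    using comp_tail[OF lunit_natural'[of v], of "del (Src C u) \<otimes> \<one> (Src C v)"]
    by (simp add: drop_left_def)
  finally show ?thesis .
qed

lemma proj_copy: "\<pi>\<^sub>1 A A \<cdot> copy A = \<one> A" "\<pi>\<^sub>2 A A \<cdot> copy A = \<one> A"
  by (simp_all add: drop_right_def drop_left_def copy_counit_right copy_counit_left)

lemma fst_pair [simp]: "Src C a = Src C b \<Longrightarrow> Tgt C a = A \<Longrightarrow> Tgt C b = B \<Longrightarrow> \<pi>\<^sub>1 A B \<cdot> \<langle>a, b\<rangle> = a"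
  by (simp add: pair_def comp_tail[OF fst_tens] proj_copy)

lemma snd_pair [simp]: "Src C a = Src C b \<Longrightarrow> Tgt C a = A \<Longrightarrow> Tgt C b = B \<Longrightarrow> \<pi>\<^sub>2 A B \<cdot> \<langle>a, b\<rangle> = b"
  by (simp add: pair_def comp_tail[OF snd_tens] proj_copy)

lemma tens_pair [simp]:
  "Src C a = Src C b \<Longrightarrow> Tgt C a = Src C u \<Longrightarrow> Tgt C b = Src C v \<Longrightarrow>
    (u \<otimes> v) \<cdot> \<langle>a, b\<rangle> = \<langle>u \<cdot> a, v \<cdot> b\<rangle>"
  by (simp add: pair_def tens_comp_tail)

lemma pair_tail [simp]:
  assumes "Src C a = Src C b" "Tgt C x = Src C b"
  shows "Tgt C a = A \<Longrightarrow> Tgt C b = B \<Longrightarrow> \<pi>\<^sub>1 A B \<cdot> \<langle>a, b\<rangle> \<cdot> x = a \<cdot> x"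
    "Tgt C a = A \<Longrightarrow> Tgt C b = B \<Longrightarrow> \<pi>\<^sub>2 A B \<cdot> \<langle>a, b\<rangle> \<cdot> x = b \<cdot> x"
    "Tgt C a = Src C u \<Longrightarrow> Tgt C b = Src C v \<Longrightarrow> (u \<otimes> v) \<cdot> \<langle>a, b\<rangle> \<cdot> x = \<langle>u \<cdot> a, v \<cdot> b\<rangle> \<cdot> x"
  using assms by (auto intro!: comp_tail)

text \<open>After composition with the invertible \<open>\<ll> \<I>\<close> both sides are morphisms
  into the terminal object.\<close>

lemma copy_unit: "copy \<I> = \<ll>i \<I>"
proof -
  have "\<ll> \<I> \<cdot> copy \<I> = \<one> \<I>"
    by (rule into_unit_eq) auto
  then have "\<ll>i \<I> \<cdot> \<ll> \<I> \<cdot> copy \<I> = \<ll>i \<I>"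
    by simp
  then show ?thesis
    by (simp add: comp_tail[OF lunit_inv_left])
qed

lemma copy_eq_pair: "copy A = \<langle>\<one> A, \<one> A\<rangle>"
  by (simp add: pair_def tens_ident)

text \<open>Naturality moves the associator past the three kernels onto the iterated copy, where
  coassociativity absorbs it. The kernels may therefore be arbitrary; \<open>swap_pair\<close> uses
  commutativity of the copy in the same way.\<close>

lemma assoc_pair:
  assumes "Src C a = Src C b" "Src C b = Src C c" "Tgt C a = A" "Tgt C b = B" "Tgt C c = D"
  shows "\<alpha> A B D \<cdot> \<langle>\<langle>a, b\<rangle>, c\<rangle> = \<langle>a, \<langle>b, c\<rangle>\<rangle>"
proof -
  let ?S = "Src C c"
  have "\<alpha> A B D \<cdot> \<langle>\<langle>a, b\<rangle>, c\<rangle> = \<alpha> A B D \<cdot> ((a \<otimes> b) \<otimes> c) \<cdot> (copy ?S \<otimes> \<one> ?S) \<cdot> copy ?S"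
    using assms by (simp add: pair_def tens_comp_tail)
  also have "\<dots> = (a \<otimes> (b \<otimes> c)) \<cdot> \<alpha> ?S ?S ?S \<cdot> (copy ?S \<otimes> \<one> ?S) \<cdot> copy ?S"
    using assms comp_tail[OF assoc_natural'[of a b c]] by simp
  also have "\<dots> = \<langle>a, \<langle>b, c\<rangle>\<rangle>"
    unfolding copy_assoc using assms by (simp add: pair_def tens_comp_tail)
  finally show ?thesis .
qed

lemma assoc_inv_pair:
  assumes "Src C a = Src C b" "Src C b = Src C c" "Tgt C a = A" "Tgt C b = B" "Tgt C c = D"
  shows "\<alpha>i A B D \<cdot> \<langle>a, \<langle>b, c\<rangle>\<rangle> = \<langle>\<langle>a, b\<rangle>, c\<rangle>"
proof -
  have "\<alpha>i A B D \<cdot> \<alpha> A B D \<cdot> \<langle>\<langle>a, b\<rangle>, c\<rangle> = \<langle>\<langle>a, b\<rangle>, c\<rangle>"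
    using assms by (simp add: comp_tail[OF assoc_inv_left])
  then show ?thesis by (simp add: assoc_pair[OF assms])
qed

lemma swap_pair:
  assumes "Src C a = Src C b" "Tgt C a = A" "Tgt C b = B"
  shows "\<sigma> A B \<cdot> \<langle>a, b\<rangle> = \<langle>b, a\<rangle>"
proof -
  have "\<sigma> A B \<cdot> \<langle>a, b\<rangle> = (b \<otimes> a) \<cdot> \<sigma> (Src C a) (Src C b) \<cdot> copy (Src C a)"
    using assms comp_tail[OF swap_natural'[of a b]] by (simp add: pair_def)
  with assms show ?thesis by (simp add: pair_def copy_commute)
qed

lemma assoc_pair_tail:
  assumes "Src C a = Src C b" "Src C b = Src C c" "Tgt C x = Src C c" "Tgt C a = A" "Tgt C b = B" "Tgt C c = D"
  shows "\<alpha> A B D \<cdot> \<langle>\<langle>a, b\<rangle>, c\<rangle> \<cdot> x = \<langle>a, \<langle>b, c\<rangle>\<rangle> \<cdot> x"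
    "\<alpha>i A B D \<cdot> \<langle>a, \<langle>b, c\<rangle>\<rangle> \<cdot> x = \<langle>\<langle>a, b\<rangle>, c\<rangle> \<cdot> x"
  using assms by (auto intro!: comp_tail assoc_pair assoc_inv_pair)

lemma swap_pair_tail:
  assumes "Src C a = Src C b" "Tgt C x = Src C b" "Tgt C a = A" "Tgt C b = B"
  shows "\<sigma> A B \<cdot> \<langle>a, b\<rangle> \<cdot> x = \<langle>b, a\<rangle> \<cdot> x"
  using assms by (auto intro!: comp_tail swap_pair)

lemmas struct_pair = assoc_pair assoc_inv_pair swap_pair assoc_pair_tail swap_pair_tail

lemma middle_swap_pair:
  assumes "Src C a = Src C b" "Src C b = Src C c" "Src C c = Src C d"
    "Tgt C a = A" "Tgt C b = B" "Tgt C c = D" "Tgt C d = E"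
  shows "middle_swap C A B D E \<cdot> \<langle>\<langle>a, b\<rangle>, \<langle>c, d\<rangle>\<rangle> = \<langle>\<langle>a, c\<rangle>, \<langle>b, d\<rangle>\<rangle>"
  using assms by (simp add: middle_swap_def struct_pair)

section \<open>Determinism of the projections and of the structure maps\<close>

text \<open>This is determinism of the first projection. Copying \<open>A \<odot> B\<close> copies
  both factors and regroups; deleting both copies of \<open>B\<close> is deleting \<open>B\<close>,
  and the regrouping collapses by \<open>runit_middle_swap\<close>.\<close>

lemma copy_fst: "copy A \<cdot> \<pi>\<^sub>1 A B = \<langle>\<pi>\<^sub>1 A B, \<pi>\<^sub>1 A B\<rangle>"
proof -
  let ?AA = "A \<odot> A"
  have "\<langle>\<pi>\<^sub>1 A B, \<pi>\<^sub>1 A B\<rangle>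
      = (\<rr> A \<otimes> \<rr> A) \<cdot> ((\<one> A \<otimes> del B) \<otimes> (\<one> A \<otimes> del B)) \<cdot> middle_swap C A A B B \<cdot> (copy A \<otimes> copy B)"
    by (simp add: pair_def drop_right_def tens_comp_tail copy_tens)
  also have "\<dots> = (\<rr> A \<otimes> \<rr> A) \<cdot> middle_swap C A A \<I> \<I> \<cdot> ((\<one> A \<otimes> \<one> A) \<otimes> (del B \<otimes> del B)) \<cdot> (copy A \<otimes> copy B)"
    using comp_tail[OF middle_swap_natural[of "\<one> A" "\<one> A" "del B" "del B"], of "copy A \<otimes> copy B"]
    by simp
  also have "\<dots> = \<rr> ?AA \<cdot> (\<one> ?AA \<otimes> \<ll> \<I>) \<cdot> ((\<one> A \<otimes> \<one> A) \<otimes> (del B \<otimes> del B)) \<cdot> (copy A \<otimes> copy B)"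
    by (simp add: comp_tail[OF runit_middle_swap])
  also have "\<dots> = \<rr> ?AA \<cdot> (copy A \<otimes> (\<ll> \<I> \<cdot> (del B \<otimes> del B) \<cdot> copy B))"
    by (simp add: tens_comp tens_ident)
  also have "\<ll> \<I> \<cdot> (del B \<otimes> del B) \<cdot> copy B = del B"
    by (rule into_unit_eq) auto
  also have "\<rr> ?AA \<cdot> (copy A \<otimes> del B) = \<rr> ?AA \<cdot> (copy A \<otimes> \<one> \<I>) \<cdot> (\<one> A \<otimes> del B)"
    by (simp add: tens_comp)
  also have "\<dots> = copy A \<cdot> \<pi>\<^sub>1 A B"
    using comp_tail[OF runit_natural'[of "copy A"], of "\<one> A \<otimes> del B"] by (simp add: drop_right_def)
  finally show ?thesis ..
qed

lemma copy_snd: "copy B \<cdot> \<pi>\<^sub>2 A B = \<langle>\<pi>\<^sub>2 A B, \<pi>\<^sub>2 A B\<rangle>"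
proof -
  let ?BB = "B \<odot> B"
  have "\<langle>\<pi>\<^sub>2 A B, \<pi>\<^sub>2 A B\<rangle>
      = (\<ll> B \<otimes> \<ll> B) \<cdot> ((del A \<otimes> \<one> B) \<otimes> (del A \<otimes> \<one> B)) \<cdot> middle_swap C A A B B \<cdot> (copy A \<otimes> copy B)"
    by (simp add: pair_def drop_left_def tens_comp_tail copy_tens)
  also have "\<dots> = (\<ll> B \<otimes> \<ll> B) \<cdot> middle_swap C \<I> \<I> B B \<cdot> ((del A \<otimes> del A) \<otimes> (\<one> B \<otimes> \<one> B)) \<cdot> (copy A \<otimes> copy B)"
    using comp_tail[OF middle_swap_natural[of "del A" "del A" "\<one> B" "\<one> B"], of "copy A \<otimes> copy B"]
    by simp
  also have "\<dots> = \<ll> ?BB \<cdot> (\<rr> \<I> \<otimes> \<one> ?BB) \<cdot> ((del A \<otimes> del A) \<otimes> (\<one> B \<otimes> \<one> B)) \<cdot> (copy A \<otimes> copy B)"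
    by (simp add: comp_tail[OF lunit_middle_swap])
  also have "\<dots> = \<ll> ?BB \<cdot> ((\<rr> \<I> \<cdot> (del A \<otimes> del A) \<cdot> copy A) \<otimes> copy B)"
    by (simp add: tens_comp tens_ident)
  also have "\<rr> \<I> \<cdot> (del A \<otimes> del A) \<cdot> copy A = del A"
    by (rule into_unit_eq) auto
  also have "\<ll> ?BB \<cdot> (del A \<otimes> copy B) = \<ll> ?BB \<cdot> (\<one> \<I> \<otimes> copy B) \<cdot> (del A \<otimes> \<one> B)"
    by (simp add: tens_comp)
  also have "\<dots> = copy B \<cdot> \<pi>\<^sub>2 A B"
    using comp_tail[OF lunit_natural'[of "copy B"], of "del A \<otimes> \<one> B"] by (simp add: drop_left_def)
  finally show ?thesis ..
qed

text \<open>Copying the product, then keeping \<open>A\<close> from one copy and \<open>B\<close>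
  from the other, is the identity by the counit laws. This eta rule allows structure maps to be
  written through projections.\<close>

lemma pair_proj [simp]: "\<langle>\<pi>\<^sub>1 A B, \<pi>\<^sub>2 A B\<rangle> = \<one> (A \<odot> B)"
proof -
  \<comment> \<open>The middle swap left over exchanges two deleted factors, and terminality makes
    the symmetry of \<open>\<I>\<close> with itself the identity.\<close>
  have "\<ll> \<I> \<cdot> \<sigma> \<I> \<I> = \<ll> \<I>"
    by (rule into_unit_eq) auto
  then have "\<ll>i \<I> \<cdot> \<ll> \<I> \<cdot> \<sigma> \<I> \<I> = \<ll>i \<I> \<cdot> \<ll> \<I>"
    by simp
  then have "\<sigma> \<I> \<I> = \<one> (\<I> \<odot> \<I>)"
    by (simp add: comp_tail[OF lunit_inv_left] lunit_inv_left)
  then have *: "middle_swap C A \<I> \<I> B = \<one> ((A \<odot> \<I>) \<odot> (\<I> \<odot> B))"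
    by (simp add: middle_swap_def tens_ident assoc_inv_left assoc_inv_right)
  have "\<langle>\<pi>\<^sub>1 A B, \<pi>\<^sub>2 A B\<rangle>
      = (\<rr> A \<otimes> \<ll> B) \<cdot> ((\<one> A \<otimes> del B) \<otimes> (del A \<otimes> \<one> B)) \<cdot> middle_swap C A A B B \<cdot> (copy A \<otimes> copy B)"
    by (simp add: pair_def drop_left_def drop_right_def tens_comp_tail copy_tens)
  also have "\<dots> = (\<rr> A \<otimes> \<ll> B) \<cdot> ((\<one> A \<otimes> del A) \<otimes> (del B \<otimes> \<one> B)) \<cdot> (copy A \<otimes> copy B)"
    using comp_tail[OF middle_swap_natural[of "\<one> A" "del A" "del B" "\<one> B"], of "copy A \<otimes> copy B"]
    by (simp add: *)
  also have "\<dots> = \<one> (A \<odot> B)"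
    by (simp add: tens_comp copy_counit_left copy_counit_right tens_ident)
  finally show ?thesis .
qed

lemma det_pair_comp [simp]:
  assumes "det d" "Src C a = Tgt C d" "Src C b = Tgt C d"
  shows "\<langle>a, b\<rangle> \<cdot> d = \<langle>a \<cdot> d, b \<cdot> d\<rangle>"
  using assms by (simp add: pair_def det_def tens_comp_tail)

lemma det_pair_comp_tail [simp]:
  assumes "det d" "Src C a = Tgt C d" "Src C b = Tgt C d" "Tgt C x = Src C d"
  shows "\<langle>a, b\<rangle> \<cdot> d \<cdot> x = \<langle>a \<cdot> d, b \<cdot> d\<rangle> \<cdot> x"
  using assms by (auto intro!: comp_tail)

lemma det_ident [simp]: "det (\<one> A)"
  by (simp add: det_def tens_ident)

lemma det_proj [simp]: "det (\<pi>\<^sub>1 A B)" "det (\<pi>\<^sub>2 A B)"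
  using copy_fst[of A B] copy_snd[of B A] by (simp_all add: det_def pair_def copy_snd)

lemma det_del [simp]: "det (del A)"
proof -
  have "\<ll> \<I> \<cdot> (del A \<otimes> del A) \<cdot> copy A = del A"
    by (rule into_unit_eq) auto
  then have "\<ll>i \<I> \<cdot> \<ll> \<I> \<cdot> (del A \<otimes> del A) \<cdot> copy A = \<ll>i \<I> \<cdot> del A"
    by simp
  then show ?thesis
    by (simp add: det_def copy_unit comp_tail[OF lunit_inv_left])
qed

lemma det_comp [simp]:
  assumes "det f" "det g" "Tgt C f = Src C g"
  shows "det (g \<cdot> f)"
proof -
  have "copy (Tgt C g) \<cdot> g \<cdot> f = (g \<otimes> g) \<cdot> copy (Src C g) \<cdot> f"
    using assms comp_tail[of "copy (Tgt C g)" g "(g \<otimes> g) \<cdot> copy (Src C g)" f] by (simp add: det_def)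
  also have "copy (Src C g) \<cdot> f = (f \<otimes> f) \<cdot> copy (Src C f)"
    using assms by (simp add: det_def)
  finally show ?thesis
    using assms by (simp add: det_def tens_comp_tail)
qed

text \<open>Apply \<open>u \<otimes> v\<close> to the identity written as the pairing of its
  projections; this is valid for arbitrary kernels \<open>u\<close> and \<open>v\<close>.\<close>

lemma tens_eq_pair:
  "u \<otimes> v = \<langle>u \<cdot> \<pi>\<^sub>1 (Src C u) (Src C v), v \<cdot> \<pi>\<^sub>2 (Src C u) (Src C v)\<rangle>"
  using tens_pair[of "\<pi>\<^sub>1 (Src C u) (Src C v)" "\<pi>\<^sub>2 (Src C u) (Src C v)" u v] by simp

text \<open>Copying a product is copying each factor followed by a middle swap, which regroups the
  two copied outputs into two copies of the pair.\<close>

lemma det_pair [simp]: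
  assumes "det a" "det b" "Src C a = Src C b"
  shows "det \<langle>a, b\<rangle>"
proof -
  let ?A = "Tgt C a" and ?B = "Tgt C b"
  have copy: "copy (Tgt C a) \<cdot> a = \<langle>a, a\<rangle>" "copy (Tgt C b) \<cdot> b = \<langle>b, b\<rangle>"
    using assms by (simp_all add: det_def pair_def)
  have "copy (?A \<odot> ?B) \<cdot> \<langle>a, b\<rangle> = middle_swap C ?A ?A ?B ?B \<cdot> (copy ?A \<otimes> copy ?B) \<cdot> \<langle>a, b\<rangle>"
    using assms by (simp add: copy_tens)
  also have "\<dots> = middle_swap C ?A ?A ?B ?B \<cdot> \<langle>\<langle>a, a\<rangle>, \<langle>b, b\<rangle>\<rangle>"
    using assms copy by simp
  also have "\<dots> = \<langle>\<langle>a, b\<rangle>, \<langle>a, b\<rangle>\<rangle>"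
    using assms by (simp add: middle_swap_pair)
  finally show ?thesis
    using assms by (simp add: det_def pair_def)
qed

lemma det_tens [simp]: "det u \<Longrightarrow> det v \<Longrightarrow> det (u \<otimes> v)"
  by (simp add: tens_eq_pair)

lemma pair_eta [simp]: "det u \<Longrightarrow> Tgt C u = A \<odot> B \<Longrightarrow> \<langle>\<pi>\<^sub>1 A B \<cdot> u, \<pi>\<^sub>2 A B \<cdot> u\<rangle> = u"
  using det_pair_comp[of u "\<pi>\<^sub>1 A B" "\<pi>\<^sub>2 A B"] by simp

text \<open>Evaluate the associator on the nested pairing of the three projections of its source,
  which is the identity. The same argument gives the next two formulas.\<close>

lemma assoc_eq:
  "\<alpha> A B D = \<langle>\<pi>\<^sub>1 A B \<cdot> \<pi>\<^sub>1 (A \<odot> B) D, \<langle>\<pi>\<^sub>2 A B \<cdot> \<pi>\<^sub>1 (A \<odot> B) D, \<pi>\<^sub>2 (A \<odot> B) D\<rangle>\<rangle>"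
  using assoc_pair[of "\<pi>\<^sub>1 A B \<cdot> \<pi>\<^sub>1 (A \<odot> B) D" "\<pi>\<^sub>2 A B \<cdot> \<pi>\<^sub>1 (A \<odot> B) D" "\<pi>\<^sub>2 (A \<odot> B) D"] by simp

lemma assoc_inv_eq:
  "\<alpha>i A B D = \<langle>\<langle>\<pi>\<^sub>1 A (B \<odot> D), \<pi>\<^sub>1 B D \<cdot> \<pi>\<^sub>2 A (B \<odot> D)\<rangle>, \<pi>\<^sub>2 B D \<cdot> \<pi>\<^sub>2 A (B \<odot> D)\<rangle>"
  using assoc_inv_pair[of "\<pi>\<^sub>1 A (B \<odot> D)" "\<pi>\<^sub>1 B D \<cdot> \<pi>\<^sub>2 A (B \<odot> D)" "\<pi>\<^sub>2 B D \<cdot> \<pi>\<^sub>2 A (B \<odot> D)"] by simp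

lemma swap_eq: "\<sigma> A B = \<langle>\<pi>\<^sub>2 A B, \<pi>\<^sub>1 A B\<rangle>"
  using swap_pair[of "\<pi>\<^sub>1 A B" "\<pi>\<^sub>2 A B"] by simp

lemma lunit_eq: "\<ll> A = \<pi>\<^sub>2 \<I> A" and runit_eq: "\<rr> A = \<pi>\<^sub>1 A \<I>"
  by (simp_all add: drop_left_def drop_right_def tens_ident)

lemma lunit_inv_eq: "\<ll>i A = \<langle>del A, \<one> A\<rangle>"
proof -
  have "\<ll>i A \<cdot> \<ll> A \<cdot> \<langle>del A, \<one> A\<rangle> = \<ll>i A"
    by (simp add: lunit_eq)
  then show ?thesis
    by (simp add: comp_tail[OF lunit_inv_left])
qed

lemma runit_inv_eq: "\<rr>i A = \<langle>\<one> A, del A\<rangle>"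
proof -
  have "\<rr>i A \<cdot> \<rr> A \<cdot> \<langle>\<one> A, del A\<rangle> = \<rr>i A"
    by (simp add: runit_eq)
  then show ?thesis
    by (simp add: comp_tail[OF runit_inv_left])
qed

lemmas struct_eq = assoc_eq assoc_inv_eq swap_eq lunit_eq runit_eq lunit_inv_eq runit_inv_eq copy_eq_pair

lemma det_struct [simp]:
  "det (\<alpha> A B D)" "det (\<alpha>i A B D)" "det (\<sigma> A B)" "det (\<ll> A)" "det (\<ll>i A)" "det (\<rr> A)"
  "det (\<rr>i A)" "det (copy A)"
  by (simp_all add: struct_eq)

section \<open>Extension by kernels, conditionals and reordering in pairing form\<close>

lemma pair_assoc_proj: "\<alpha>i A B D \<cdot> (\<one> A \<otimes> \<langle>u, v\<rangle>) = \<langle>\<langle>\<pi>\<^sub>1 A (Src C u), u \<cdot> \<pi>\<^sub>2 A (Src C u)\<rangle>, v \<cdot> \<pi>\<^sub>2 A (Src C u)\<rangle>"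
  if "Src C u = Src C v" "Tgt C u = B" "Tgt C v = D"
  using that by (simp add: tens_eq_pair[of "\<one> A"] assoc_inv_pair)

text \<open>The right-hand side shows that only \<open>B\<close> is really duplicated, although the
  pairing formally copies all of \<open>A \<odot> B\<close>.\<close>

lemma extend_snd: "Src C h = B \<Longrightarrow> \<langle>\<one> (A \<odot> B), h \<cdot> \<pi>\<^sub>2 A B\<rangle> = \<alpha>i A B (Tgt C h) \<cdot> (\<one> A \<otimes> \<langle>\<one> B, h\<rangle>)"
  by (simp add: pair_assoc_proj)

text \<open>Only \<open>b\<close> is duplicated, hence only \<open>b\<close> has to be deterministic
  while \<open>a\<close> may be random.\<close>

lemma extend_pair:
  assumes "det b" "Src C a = Src C b" "Tgt C a = A" "Tgt C b = B" "Src C h = B"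
  shows "\<langle>\<one> (A \<odot> B), h \<cdot> \<pi>\<^sub>2 A B\<rangle> \<cdot> \<langle>a, b\<rangle> = \<langle>\<langle>a, b\<rangle>, h \<cdot> b\<rangle>"
  using assms by (simp add: extend_snd assoc_inv_pair)

text \<open>The explicit copying and rebracketing collapse to one pairing: the marginal on
  \<open>Y\<close> is taken next to the input, and \<open>c\<close> is then run beside a retained
  copy of \<open>Y\<close>.\<close>

lemma conditional_iff:
  assumes "Src C h = A" "Tgt C h = X \<odot> Y"
  shows "is_conditional C A X Y h c \<longleftrightarrow>
    Src C c = A \<odot> Y \<and> Tgt C c = X \<and> h = \<langle>c, \<pi>\<^sub>2 A Y\<rangle> \<cdot> \<langle>\<one> A, \<pi>\<^sub>2 X Y \<cdot> h\<rangle>"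
proof -
  have "(c \<otimes> \<one> Y) \<cdot> \<alpha>i A Y Y \<cdot> (\<one> A \<otimes> copy Y) \<cdot> (\<one> A \<otimes> (\<pi>\<^sub>2 X Y \<cdot> h)) \<cdot> copy A
      = \<langle>c, \<pi>\<^sub>2 A Y\<rangle> \<cdot> \<langle>\<one> A, \<pi>\<^sub>2 X Y \<cdot> h\<rangle>" if "Src C c = A \<odot> Y"
  proof -
    have "(c \<otimes> \<one> Y) \<cdot> \<alpha>i A Y Y \<cdot> (\<one> A \<otimes> copy Y) = (c \<otimes> \<one> Y) \<cdot> \<langle>\<one> (A \<odot> Y), \<pi>\<^sub>2 A Y\<rangle>"
      by (simp add: copy_eq_pair pair_assoc_proj)
    also have "\<dots> = \<langle>c, \<pi>\<^sub>2 A Y\<rangle>"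
      using that by simp
    finally show ?thesis
      using assms that comp_tail[of "c \<otimes> \<one> Y" "\<alpha>i A Y Y \<cdot> (\<one> A \<otimes> copy Y)" "\<langle>c, \<pi>\<^sub>2 A Y\<rangle>" "(\<one> A \<otimes> (\<pi>\<^sub>2 X Y \<cdot> h)) \<cdot> copy A"]
      by (simp add: pair_def)
  qed
  then show ?thesis
    by (auto simp: is_conditional_def Hom_def)
qed

lemma tens_copy_eq_pair: "Src C a = A \<Longrightarrow> Src C b = A \<Longrightarrow> (a \<otimes> b) \<cdot> copy A = \<langle>a, b\<rangle>"
  by (simp add: pair_def)

lemma tens_copy_tail:
  "Src C a = A \<Longrightarrow> Src C b = A \<Longrightarrow> Tgt C x = A \<Longrightarrow> (a \<otimes> b) \<cdot> copy A \<cdot> x = \<langle>a, b\<rangle> \<cdot> x"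
  by (simp add: pair_def)

text \<open>This is the permutation by which \<open>keep_YX\<close> moves a retained hidden state
  past the next observation.\<close>

definition rotate :: "'o \<Rightarrow> 'o \<Rightarrow> 'o \<Rightarrow> 'm" where
  "rotate A B D = \<alpha>i A D B \<cdot> (\<one> A \<otimes> \<sigma> B D) \<cdot> \<alpha> A B D"

lemma Src_rotate [simp]: "Src C (rotate A B D) = (A \<odot> B) \<odot> D"
  and Tgt_rotate [simp]: "Tgt C (rotate A B D) = (A \<odot> D) \<odot> B"
  by (simp_all add: rotate_def)

lemma rotate_pair:
  assumes "Src C a = Src C b" "Src C b = Src C d" "Tgt C a = A" "Tgt C b = B" "Tgt C d = D"
  shows "rotate A B D \<cdot> \<langle>\<langle>a, b\<rangle>, d\<rangle> = \<langle>\<langle>a, d\<rangle>, b\<rangle>"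
  using assms by (simp add: rotate_def struct_pair)

text \<open>These hold although \<open>u\<close> need not be deterministic, because only the deterministic
  component of the pair is duplicated.\<close>

lemma retain_fst:
  assumes "det a" "Src C u = Src C a" "Tgt C a = A" "Tgt C u = B"
  shows "\<langle>\<pi>\<^sub>1 A B, \<one> (A \<odot> B)\<rangle> \<cdot> \<langle>a, u\<rangle> = \<langle>a, \<langle>a, u\<rangle>\<rangle>"
proof -
  have "\<langle>\<pi>\<^sub>1 A B, \<one> (A \<odot> B)\<rangle> = \<alpha> A A B \<cdot> (copy A \<otimes> \<one> B)"
    by (simp add: struct_eq tens_eq_pair)
  then show ?thesis
    using assms by (simp add: copy_eq_pair struct_pair)
qed

lemma distribute_fst:
  assumes "Src C h = D" "Tgt C h = B"
  shows "\<langle>\<langle>\<pi>\<^sub>1 A (B \<odot> D), \<pi>\<^sub>1 B D \<cdot> \<pi>\<^sub>2 A (B \<odot> D)\<rangle>, \<langle>\<pi>\<^sub>1 A (B \<odot> D), \<pi>\<^sub>2 B D \<cdot> \<pi>\<^sub>2 A (B \<odot> D)\<rangle>\<rangle> \<cdot> (\<one> A \<otimes> \<langle>h, \<one> D\<rangle>)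
    = \<langle>\<langle>\<pi>\<^sub>1 A D, h \<cdot> \<pi>\<^sub>2 A D\<rangle>, \<one> (A \<odot> D)\<rangle>" (is "?dist \<cdot> _ = _")
proof -
  \<comment> \<open>In this form the duplication touches \<open>A\<close> alone, so the kernel
    \<open>h\<close> in the other factor is run only once.\<close>
  have "?dist = middle_swap C A A B D \<cdot> (copy A \<otimes> \<one> (B \<odot> D))"
    using middle_swap_pair[of "\<pi>\<^sub>1 A (B \<odot> D)" "\<pi>\<^sub>1 A (B \<odot> D)" "\<pi>\<^sub>1 B D \<cdot> \<pi>\<^sub>2 A (B \<odot> D)" "\<pi>\<^sub>2 B D \<cdot> \<pi>\<^sub>2 A (B \<odot> D)"]
    by (simp add: tens_eq_pair copy_eq_pair)
  then have "?dist \<cdot> (\<one> A \<otimes> \<langle>h, \<one> D\<rangle>) = middle_swap C A A B D \<cdot> (copy A \<otimes> \<langle>h, \<one> D\<rangle>)"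
    using assms by (simp add: tens_comp)
  also have "copy A \<otimes> \<langle>h, \<one> D\<rangle> = \<langle>\<langle>\<pi>\<^sub>1 A D, \<pi>\<^sub>1 A D\<rangle>, \<langle>h \<cdot> \<pi>\<^sub>2 A D, \<pi>\<^sub>2 A D\<rangle>\<rangle>"
    using assms by (simp add: tens_eq_pair copy_eq_pair)
  also have "middle_swap C A A B D \<cdot> \<dots> = \<langle>\<langle>\<pi>\<^sub>1 A D, h \<cdot> \<pi>\<^sub>2 A D\<rangle>, \<one> (A \<odot> D)\<rangle>"
    using assms by (simp add: middle_swap_pair)
  finally show ?thesis .
qed

lemma assoc_inv_tens_pair:
  assumes "Src C u = Src C v" "Tgt C a = A" "Tgt C u = B" "Tgt C v = D"
  shows "\<alpha>i A B D \<cdot> (a \<otimes> \<langle>u, v\<rangle>) = \<langle>a \<otimes> u, v \<cdot> \<pi>\<^sub>2 (Src C a) (Src C u)\<rangle>"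
  using assms by (simp add: tens_eq_pair[of a] assoc_inv_pair)

lemma rotate_tens_pair:
  assumes "Src C a = Src C d" "Tgt C a = A" "Tgt C d = B" "Tgt C b = D"
  shows "rotate A B D \<cdot> (\<langle>a, d\<rangle> \<otimes> b) = \<langle>a \<otimes> b, d \<cdot> \<pi>\<^sub>1 (Src C a) (Src C b)\<rangle>"
  using assms by (simp add: tens_eq_pair[of _ b] rotate_pair)

text \<open>The counterpart of \<open>extend_pair\<close> in which \<open>h\<close> reads the first
  component; now \<open>a\<close> is the component that is duplicated.\<close>

lemma extend_fst_pair:
  assumes "det a" "Src C b = Src C a" "Tgt C a = A" "Tgt C b = B" "Src C h = A"
  shows "\<langle>\<one> (A \<odot> B), h \<cdot> \<pi>\<^sub>1 A B\<rangle> \<cdot> \<langle>a, b\<rangle> = \<langle>\<langle>a, b\<rangle>, h \<cdot> a\<rangle>"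
proof -
  have "\<langle>\<one> (A \<odot> B), h \<cdot> \<pi>\<^sub>1 A B\<rangle> = rotate A (Tgt C h) B \<cdot> (\<langle>\<one> A, h\<rangle> \<otimes> \<one> B)"
    using assms by (simp add: rotate_tens_pair tens_ident)
  with assms show ?thesis by (simp add: rotate_pair)
qed

text \<open>The hypothesis \<open>F\<close> says that \<open>q\<close> reads the input of
  \<open>F\<close> back from its output. The extra output of \<open>h\<close> does not affect this
  readout, which can be done before the extension. This is the inductive step of
  \<open>future_head\<close>.\<close>

lemma retain_input:
  assumes [simp]: "Src C q = A" "Tgt C q = D" "Src C h = A" "Tgt C h = B" "Src C F = D" "Tgt C F = A"
    and F: "\<langle>\<one> A, q\<rangle> \<cdot> F = \<langle>F, \<one> D\<rangle>"
  shows "\<langle>\<one> (A \<odot> B), q \<cdot> \<pi>\<^sub>1 A B\<rangle> \<cdot> \<langle>\<one> A, h\<rangle> \<cdot> F = \<langle>\<langle>\<one> A, h\<rangle> \<cdot> F, \<one> D\<rangle>"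
proof -
  have "\<langle>\<one> (A \<odot> B), q \<cdot> \<pi>\<^sub>1 A B\<rangle> \<cdot> \<langle>\<one> A, h\<rangle> = (\<langle>\<one> A, h\<rangle> \<otimes> \<one> D) \<cdot> \<langle>\<one> A, q\<rangle>"
    by (simp add: extend_fst_pair)
  then have "\<langle>\<one> (A \<odot> B), q \<cdot> \<pi>\<^sub>1 A B\<rangle> \<cdot> \<langle>\<one> A, h\<rangle> \<cdot> F = (\<langle>\<one> A, h\<rangle> \<otimes> \<one> D) \<cdot> \<langle>\<one> A, q\<rangle> \<cdot> F"
    using comp_tail[of "\<langle>\<one> (A \<odot> B), q \<cdot> \<pi>\<^sub>1 A B\<rangle>" "\<langle>\<one> A, h\<rangle>" _ F] by simp
  then show ?thesis by (simp add: F)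
qed

text \<open>Pairing with a deletion only adds a unit factor, so it passes through any kernel, random
  or not.\<close>

lemma pair_del: "Tgt C u = A \<Longrightarrow> \<langle>\<one> A, del A\<rangle> \<cdot> u = \<langle>u, del (Src C u)\<rangle>"
  using comp_tail[OF runit_inv_left[of A], of "\<langle>u, del (Src C u)\<rangle>"]
  by (simp add: runit_eq runit_inv_eq del: det_pair_comp)

section \<open>Finite tensor products\<close>

lemma Src_tens_mors: "(\<And>i. i < k \<Longrightarrow> Src C (h i) = F i) \<Longrightarrow> Src C (tens_mors C h k) = tens_objs C F k"
  by (induction k) auto

lemma Tgt_tens_mors: "(\<And>i. i < k \<Longrightarrow> Tgt C (h i) = F i) \<Longrightarrow> Tgt C (tens_mors C h k) = tens_objs C F k"
  by (induction k) auto

lemma tens_mors_comp: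
  "(\<And>i. i < k \<Longrightarrow> Tgt C (h i) = Src C (h' i)) \<Longrightarrow>
    tens_mors C h' k \<cdot> tens_mors C h k = tens_mors C (\<lambda>i. h' i \<cdot> h i) k"
proof (induction k)
  case (Suc k)
  then have "Tgt C (tens_mors C h k) = Src C (tens_mors C h' k)"
    using Tgt_tens_mors[of k h "\<lambda>i. Src C (h' i)"] Src_tens_mors[of k h' "\<lambda>i. Src C (h' i)"] by simp
  with Suc show ?case by (simp add: tens_comp)
qed simp

lemma tens_mors_cong: "(\<And>i. i < k \<Longrightarrow> h i = h' i) \<Longrightarrow> tens_mors C h k = tens_mors C h' k"
  by (induction k) auto

lemma Src_tens_join [simp]: "Src C (tens_join C F k j) = tens_objs C F k \<odot> tens_objs C (\<lambda>i. F (k + i)) j"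
  and Tgt_tens_join [simp]: "Tgt C (tens_join C F k j) = tens_objs C F (k + j)"
  by (induction j) auto

lemma Src_tens_split [simp]: "Src C (tens_split C F k j) = tens_objs C F (k + j)"
  and Tgt_tens_split [simp]: "Tgt C (tens_split C F k j) = tens_objs C F k \<odot> tens_objs C (\<lambda>i. F (k + i)) j"
  by (induction j) auto

lemma det_tens_join [simp]: "det (tens_join C F k j)"
  by (induction j) auto

lemma det_tens_split [simp]: "det (tens_split C F k j)"
  by (induction j) auto

lemma tens_join_split: "tens_join C F k j \<cdot> tens_split C F k j = \<one> (tens_objs C F (k + j))"
  by (induction j)
    (simp_all add: runit_inv_right comp_tail[OF assoc_inv_left] tens_comp tens_ident)

lemma tens_split_join:
  "tens_split C F k j \<cdot> tens_join C F k j = \<one> (tens_objs C F k \<odot> tens_objs C (\<lambda>i. F (k + i)) j)"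
  by (induction j)
    (simp_all add: runit_inv_left tens_comp_tail tens_ident assoc_inv_right)

lemma tens_join_natural:
  assumes "\<And>i. i < k + j \<Longrightarrow> Src C (h i) = F i" "\<And>i. i < k + j \<Longrightarrow> Tgt C (h i) = F' i"
  shows "tens_join C F' k j \<cdot> (tens_mors C h k \<otimes> tens_mors C (\<lambda>i. h (k + i)) j)
    = tens_mors C h (k + j) \<cdot> tens_join C F k j"
  using assms
proof (induction j)
  case 0
  then have "Src C (tens_mors C h k) = tens_objs C F k" "Tgt C (tens_mors C h k) = tens_objs C F' k"
    by (auto intro: Src_tens_mors Tgt_tens_mors)
  then show ?case using runit_natural'[of "tens_mors C h k"] by simp
next
  case (Suc j)
  let ?h1 = "tens_mors C h k" and ?h2 = "tens_mors C (\<lambda>i. h (k + i)) j" and ?h3 = "h (k + j)"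
  have [simp]: "Src C ?h1 = tens_objs C F k" "Tgt C ?h1 = tens_objs C F' k"
    "Src C ?h2 = tens_objs C (\<lambda>i. F (k + i)) j" "Tgt C ?h2 = tens_objs C (\<lambda>i. F' (k + i)) j"
    "Src C ?h3 = F (k + j)" "Tgt C ?h3 = F' (k + j)"
    "Src C (tens_mors C h (k + j)) = tens_objs C F (k + j)"
    using Suc.prems by (auto intro!: Src_tens_mors Tgt_tens_mors)
  have "tens_join C F' k j \<cdot> (?h1 \<otimes> ?h2) = tens_mors C h (k + j) \<cdot> tens_join C F k j"
    using Suc by simp
  then show ?case
    using assoc_inv_natural'[of ?h1 ?h2 ?h3] by (simp add: tens_comp_tail)
qed

section \<open>Coordinate projections and regrouping of tensor products\<close>

text \<open>The projection to factor \<open>t\<close> is indexed by the number \<open>j\<close> of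
  factors after it, so that the recursion follows the left-nested bracketing.\<close>

primrec tens_proj :: "(nat \<Rightarrow> 'o) \<Rightarrow> nat \<Rightarrow> nat \<Rightarrow> 'm" where
  "tens_proj F t 0 = \<pi>\<^sub>2 (tens_objs C F t) (F t)"
| "tens_proj F t (Suc j) = tens_proj F t j \<cdot> \<pi>\<^sub>1 (tens_objs C F (Suc t + j)) (F (Suc t + j))"

lemma Src_tens_proj [simp]: "Src C (tens_proj F t j) = tens_objs C F (Suc t + j)"
  and Tgt_tens_proj [simp]: "Tgt C (tens_proj F t j) = F t"
  by (induction j) auto

lemma tens_proj_join_left:
  "tens_proj F t j \<cdot> tens_join C F (Suc t) j
    = \<pi>\<^sub>2 (tens_objs C F t) (F t) \<cdot> \<pi>\<^sub>1 (tens_objs C F (Suc t)) (tens_objs C (\<lambda>i. F (Suc t + i)) j)"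
proof (induction j)
  case (Suc j)
  then show ?case
    by (simp add: comp_tail[OF fst_tens] comp_tail[OF Suc[simplified]] assoc_inv_eq)
qed (simp add: runit_eq)

text \<open>Factor \<open>k\<close> becomes factor 0 of the right block, which is nonempty because
  it has \<open>Suc j\<close> factors.\<close>

lemma tens_proj_join_right:
  "tens_proj F k j \<cdot> tens_join C F k (Suc j)
    = tens_proj (\<lambda>i. F (k + i)) 0 j \<cdot> \<pi>\<^sub>2 (tens_objs C F k) (tens_objs C (\<lambda>i. F (k + i)) (Suc j))"
proof (induction j)
  case 0
  show ?case by (simp add: comp_tail[OF snd_tens] assoc_inv_eq)
next
  case (Suc j)
  have *: "tens_proj F k j \<cdot> tens_join C F k (Suc j) \<cdot> x = tens_proj (\<lambda>i. F (k + i)) 0 j \<cdot> \<pi>\<^sub>2 (tens_objs C F k) (tens_objs C (\<lambda>i. F (k + i)) (Suc j)) \<cdot> x"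
    if "Tgt C x = tens_objs C F k \<odot> tens_objs C (\<lambda>i. F (k + i)) (Suc j)" for x
    using that comp_tail[OF Suc, of x] by simp
  show ?case
    using * by (simp add: comp_tail[OF fst_tens] assoc_inv_eq del: tens_join.simps(2) add: tens_join.simps(2)[of C F k "Suc j"])
qed

text \<open>All maps involved are deterministic, so duplicating the initial block and rejoining
  amounts to keeping everything and reading off that block once more.\<close>

lemma copy_upto_eq:
  assumes "t \<le> n"
  shows "copy_upto C F t n =
    \<langle>\<pi>\<^sub>1 (upto_objs C F t) (after_objs C F t n) \<cdot> tens_split C F (Suc t) (n - t), \<one> (upto_objs C F n)\<rangle>"
proof -
  let ?U = "tens_objs C F (Suc t)" and ?V = "tens_objs C (\<lambda>i. F (Suc (t + i))) (n - t)"
  have "\<alpha> ?U ?U ?V \<cdot> (copy ?U \<otimes> \<one> ?V) = \<langle>\<pi>\<^sub>1 ?U ?V, \<one> (?U \<odot> ?V)\<rangle>"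
    by (simp add: struct_eq tens_eq_pair)
  then show ?thesis
    using assms tens_join_split[of F "Suc t" "n - t"]
      comp_tail[of "\<alpha> ?U ?U ?V" "copy ?U \<otimes> \<one> ?V" "\<langle>\<pi>\<^sub>1 ?U ?V, \<one> (?U \<odot> ?V)\<rangle>" "tens_split C F (Suc t) (n - t)"]
    by (simp add: copy_upto_def upto_objs_def after_objs_def del: tens_objs.simps)
qed

text \<open>Removes the unit source and the swap from the definition of a posterior. What is left is
  a disintegration: the joint state is its marginal followed by \<open>b\<close> beside a retained
  copy.\<close>

lemma conditional_of_state:
  assumes "is_conditional C \<I> B A (\<sigma> A B \<cdot> \<langle>u, v\<rangle> \<cdot> m) (b \<cdot> \<ll> A)"
    and [simp]: "Src C u = Tgt C m" "Src C v = Tgt C m" "Tgt C u = A" "Tgt C v = B"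
      "Src C m = \<I>" "Src C b = A" "Tgt C b = B"
  shows "\<langle>u, v\<rangle> \<cdot> m = \<langle>\<one> A, b\<rangle> \<cdot> u \<cdot> m"
proof -
  have "\<langle>v, u\<rangle> \<cdot> m = \<langle>b \<cdot> \<pi>\<^sub>2 \<I> A, \<pi>\<^sub>2 \<I> A\<rangle> \<cdot> \<langle>\<one> \<I>, u \<cdot> m\<rangle>"
    using assms(1) by (simp add: struct_pair conditional_iff lunit_eq)
  also have "\<dots> = (\<langle>b, \<one> A\<rangle> \<cdot> \<pi>\<^sub>2 \<I> A) \<cdot> \<langle>\<one> \<I>, u \<cdot> m\<rangle>"
    by (simp del: comp_assoc')
  also have "\<dots> = \<langle>b, \<one> A\<rangle> \<cdot> u \<cdot> m"
    by (subst comp_assoc') simp_all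
  finally have "\<sigma> B A \<cdot> \<langle>v, u\<rangle> \<cdot> m = \<sigma> B A \<cdot> \<langle>b, \<one> A\<rangle> \<cdot> u \<cdot> m"
    by simp
  then show ?thesis
    by (simp add: struct_pair)
qed

end

section \<open>Hidden Markov models\<close>

text \<open>The transition assumptions include the step from \<open>n\<close> to
  \<open>Suc n\<close>. With \<open>last_unit\<close> the final deletion is then an ordinary
  transition, and terminality identifies it.\<close>

locale hidden_markov = markov_category C
  for C :: "('o, 'm, 'z) markov_data_scheme" (structure) +
  fixes n :: nat and X Y :: "nat \<Rightarrow> 'o" and f g :: "nat \<Rightarrow> 'm"
  assumes Src_init [simp]: "Src C (f 0) = \<I>"
    and Tgt_init [simp]: "Tgt C (f 0) = X 0"
    and Src_trans [simp]: "t \<le> n \<Longrightarrow> Src C (f (Suc t)) = X t"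
    and Tgt_trans [simp]: "t \<le> n \<Longrightarrow> Tgt C (f (Suc t)) = X (Suc t)"
    and Src_obs [simp]: "t \<le> n \<Longrightarrow> Src C (g t) = X t"
    and Tgt_obs [simp]: "t \<le> n \<Longrightarrow> Tgt C (g t) = Y t"
    and last_unit: "X (Suc n) = \<I>"
begin

abbreviation chain :: "nat \<Rightarrow> 'm" where "chain \<equiv> hmm_chain C X f"
abbreviation obs :: "nat \<Rightarrow> 'm" where "obs s \<equiv> tens_mors C g (Suc s)"
abbreviation state :: "nat \<Rightarrow> 'm" where "state s \<equiv> hmm_state C s X f g"

lemma Src_chain [simp]: "t \<le> Suc n \<Longrightarrow> Src C (chain t) = \<I>"
  and Tgt_chain [simp]: "t \<le> Suc n \<Longrightarrow> Tgt C (chain t) = tens_objs C X t \<odot> X t"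
proof (induction t)
  case (Suc t)
  { case 1 with Suc show ?case by (simp add: tens_copy_eq_pair) }
  { case 2 with Suc show ?case by (simp add: tens_copy_eq_pair) }
qed simp_all

lemma chain_Suc:
  "t \<le> n \<Longrightarrow> chain (Suc t) = \<langle>\<one> (tens_objs C X t \<odot> X t), f (Suc t) \<cdot> \<pi>\<^sub>2 (tens_objs C X t) (X t)\<rangle> \<cdot> chain t"
  by (simp add: extend_snd tens_copy_eq_pair)

lemma Src_obs_tens [simp]: "k \<le> Suc n \<Longrightarrow> Src C (tens_mors C g k) = tens_objs C X k"
  and Tgt_obs_tens [simp]: "k \<le> Suc n \<Longrightarrow> Tgt C (tens_mors C g k) = tens_objs C Y k"
  by (auto intro!: Src_tens_mors Tgt_tens_mors)

abbreviation emit :: "nat \<Rightarrow> 'm" where "emit k \<equiv> tens_mors C (\<lambda>t. (\<one> (X t) \<otimes> g t) \<cdot> copy (X t)) k"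

lemma Src_emit [simp]: "k \<le> Suc n \<Longrightarrow> Src C (emit k) = tens_objs C X k"
  and Tgt_emit [simp]: "k \<le> Suc n \<Longrightarrow> Tgt C (emit k) = tens_objs C (\<lambda>i. X i \<odot> Y i) k"
  by (auto intro!: Src_tens_mors Tgt_tens_mors)

lemma Src_state [simp]: "s \<le> n \<Longrightarrow> Src C (state s) = \<I>"
  and Tgt_state [simp]: "s \<le> n \<Longrightarrow> Tgt C (state s) = tens_objs C (\<lambda>i. X i \<odot> Y i) (Suc s)"
  by (simp_all add: hmm_state_def del: hmm_chain.simps)

lemma truncate_hom [simp]:
  "Src C (truncate C F k j) = tens_objs C F (k + j)" "Tgt C (truncate C F k j) = tens_objs C F k"
  by (induction j) auto

text \<open>A discarded factor comes from extending the shorter chain and then emitting locally;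
  dropping it undoes the extension, since a marginal of a pairing is the other component.\<close>

lemma truncate_state:
  "s + j \<le> n \<Longrightarrow> truncate C (\<lambda>i. X i \<odot> Y i) (Suc s) j \<cdot> state (s + j) = state s"
proof (induction j)
  case (Suc j)
  let ?XY = "\<lambda>i. X i \<odot> Y i"
  have "\<pi>\<^sub>1 (tens_objs C ?XY (Suc (s + j))) (?XY (Suc (s + j))) \<cdot> state (Suc (s + j)) = state (s + j)"
    using Suc.prems
    by (simp add: hmm_state_def chain_Suc comp_tail[OF fst_tens] tens_copy_eq_pair del: hmm_chain.simps)
  with Suc show ?case by simp
qed simp

lemma drop_emit:
  "k \<le> Suc n \<Longrightarrow> tens_mors C (\<lambda>i. \<pi>\<^sub>2 (X i) (Y i)) k \<cdot> emit k = tens_mors C g k"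
  by (subst tens_mors_comp) (auto intro!: tens_mors_cong simp: tens_copy_eq_pair)

lemma keep_YX_hom [simp]:
  "Src C (keep_YX C X Y t j) = tens_objs C (\<lambda>i. X i \<odot> Y i) (Suc (t + j))"
  "Tgt C (keep_YX C X Y t j) = tens_objs C Y (Suc (t + j)) \<odot> X t"
proof (induction j)
  case 0
  have "Src C (tens_mors C (\<lambda>i. \<pi>\<^sub>2 (X i) (Y i)) t) = tens_objs C (\<lambda>i. X i \<odot> Y i) t"
    "Tgt C (tens_mors C (\<lambda>i. \<pi>\<^sub>2 (X i) (Y i)) t) = tens_objs C Y t"
    by (auto intro!: Src_tens_mors Tgt_tens_mors)
  note [simp] = this
  { case 1 show ?case by simp }
  { case 2 show ?case by simp }
next
  case (Suc j)
  { case 1 show ?case using Suc by (simp add: upto_objs_def) }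
  { case 2 show ?case using Suc by (simp add: upto_objs_def) }
qed

text \<open>At each time the emission pairs a hidden state with its observation, so deleting the
  hidden state leaves \<open>g\<close>. Only \<open>X t\<close> survives, and each later observation
  is moved past it by \<open>rotate\<close>.\<close>

lemma keep_YX_emit:
  "t + j \<le> n \<Longrightarrow> keep_YX C X Y t j \<cdot> emit (Suc (t + j)) = \<langle>obs (t + j), tens_proj X t j\<rangle>"
proof (induction j)
  case 0
  have [simp]: "Src C (tens_mors C (\<lambda>i. \<pi>\<^sub>2 (X i) (Y i)) t) = tens_objs C (\<lambda>i. X i \<odot> Y i) t"
    "Tgt C (tens_mors C (\<lambda>i. \<pi>\<^sub>2 (X i) (Y i)) t) = tens_objs C Y t"
    by (auto intro!: Src_tens_mors Tgt_tens_mors)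
  from 0 show ?case
    by (simp add: tens_comp tens_copy_eq_pair drop_emit swap_pair assoc_inv_tens_pair)
next
  case (Suc j)
  then have "keep_YX C X Y t (Suc j) \<cdot> emit (Suc (t + Suc j))
      = rotate (upto_objs C Y (t + j)) (X t) (Y (Suc (t + j))) \<cdot>
        (\<langle>obs (t + j), tens_proj X t j\<rangle> \<otimes> g (Suc (t + j)))"
    by (simp add: rotate_def tens_comp tens_copy_eq_pair upto_objs_def)
  also have "\<dots> = \<langle>obs (t + Suc j), tens_proj X t (Suc j)\<rangle>"
    using Suc.prems by (simp add: rotate_tens_pair upto_objs_def)
  finally show ?case .
qed

lemma marginal_Y_eq: "marginal_Y C n X Y n (state n) = obs n \<cdot> chain n"
proof -
  have "Src C (tens_mors C (\<lambda>i. \<pi>\<^sub>2 (X i) (Y i)) (Suc n)) = tens_objs C (\<lambda>i. X i \<odot> Y i) (Suc n)"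
    by (rule Src_tens_mors) simp
  then show ?thesis
    using comp_tail[OF drop_emit[of "Suc n"], of "chain n"]
    by (simp add: marginal_Y_def hmm_state_def del: tens_mors.simps hmm_chain.simps)
qed

lemma marginal_YX_eq:
  assumes "t \<le> s" "s \<le> n"
  shows "marginal_YX C n X Y s t (state n) = \<langle>obs s, tens_proj X t (s - t)\<rangle> \<cdot> chain s"
proof -
  have "marginal_YX C n X Y s t (state n) = keep_YX C X Y t (s - t) \<cdot> state s"
    using assms truncate_state[of s "n - s"] by (simp add: marginal_YX_def)
  also have "\<dots> = \<langle>obs s, tens_proj X t (s - t)\<rangle> \<cdot> chain s"
    using assms comp_tail[OF keep_YX_emit[of t "s - t"], of "chain s"]
    by (simp add: hmm_state_def del: tens_mors.simps hmm_chain.simps)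
  finally show ?thesis .
qed

text \<open>The disintegration form in which filters and smoothers are used below.\<close>

lemma posteriorD:
  assumes "posterior C n X Y (state n) s t b" "t \<le> s" "s \<le> n"
  shows "Src C b = upto_objs C Y s" "Tgt C b = X t"
    "\<langle>obs s, tens_proj X t (s - t)\<rangle> \<cdot> chain s = \<langle>\<one> (upto_objs C Y s), b\<rangle> \<cdot> obs s \<cdot> chain s"
proof -
  show b: "Src C b = upto_objs C Y s" "Tgt C b = X t"
    using assms by (auto simp: posterior_def Hom_def)
  show "\<langle>obs s, tens_proj X t (s - t)\<rangle> \<cdot> chain s = \<langle>\<one> (upto_objs C Y s), b\<rangle> \<cdot> obs s \<cdot> chain s"
  proof (rule conditional_of_state)
    show "is_conditional C \<I> (X t) (upto_objs C Y s)
      (\<sigma> (upto_objs C Y s) (X t) \<cdot> \<langle>obs s, tens_proj X t (s - t)\<rangle> \<cdot> chain s) (b \<cdot> \<ll> (upto_objs C Y s))"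
      using assms by (simp add: posterior_def marginal_YX_eq)
  qed (use assms b in \<open>simp_all add: upto_objs_def\<close>)
qed

section \<open>The hidden chain restarted at time t+1\<close>

text \<open>The kernel from \<open>X (Suc t)\<close> to the segment from \<open>X (Suc t)\<close>
  through \<open>X (Suc (t + j))\<close>, by the same recursion as \<open>chain_Suc\<close>. The
  initial state is part of the output.\<close>

primrec future :: "nat \<Rightarrow> nat \<Rightarrow> 'm" where
  "future t 0 = \<ll>i (X (Suc t))"
| "future t (Suc j) =
    \<langle>\<one> (tens_objs C (\<lambda>i. X (Suc t + i)) j \<odot> X (Suc t + j)),
      f (Suc (Suc t + j)) \<cdot> \<pi>\<^sub>2 (tens_objs C (\<lambda>i. X (Suc t + i)) j) (X (Suc t + j))\<rangle> \<cdot> future t j"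

lemma future_hom [simp]:
  assumes "t + j \<le> n"
  shows "Src C (future t j) = X (Suc t)"
    "Tgt C (future t j) = tens_objs C (\<lambda>i. X (Suc (t + i))) j \<odot> X (Suc (t + j))"
  using assms by (induction j) auto

text \<open>The Markov property: a new transition reads only the last state, which lies in the right
  block, so the past block is carried along unchanged.\<close>

lemma chain_future:
  "t + j \<le> n \<Longrightarrow> chain (Suc (t + j)) = tens_join C X (Suc t) (Suc j) \<cdot> (\<one> (tens_objs C X (Suc t)) \<otimes> future t j) \<cdot> chain (Suc t)"
proof (induction j)
  case 0
  have "tens_join C X (Suc t) (Suc 0) \<cdot> (\<one> (tens_objs C X (Suc t)) \<otimes> future t 0) = \<one> (tens_objs C X (Suc t) \<odot> X (Suc t))"
    by (simp add: comp_tail[OF triangle_inv] runit_eq[symmetric] triangle_inv tens_comp lunit_inv_right tens_ident)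
  then show ?case
    using 0 comp_tail[of "tens_join C X (Suc t) (Suc 0)" "\<one> (tens_objs C X (Suc t)) \<otimes> future t 0" _ "chain (Suc t)"]
    by (simp del: tens_join.simps(2) hmm_chain.simps future.simps)
next
  case (Suc j)
  let ?J = "tens_join C X (Suc t) (Suc j)"
  let ?A = "tens_objs C X (Suc t)" and ?B = "tens_objs C (\<lambda>i. X (Suc (t + i))) j" and ?D = "X (Suc (t + j))"
  let ?h = "f (Suc (Suc (t + j)))"
  have [simp]: "Src C ?J = ?A \<odot> (?B \<odot> ?D)" "Tgt C ?J = tens_objs C X (Suc (t + j)) \<odot> ?D" "det ?J"
    by simp_all
  have pJ: "\<pi>\<^sub>2 (tens_objs C X (t + j) \<odot> X (t + j)) ?D \<cdot> ?J = \<pi>\<^sub>2 ?B ?D \<cdot> \<pi>\<^sub>2 ?A (?B \<odot> ?D)"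
    by (simp add: comp_tail[OF snd_tens] assoc_inv_eq)
  have "chain (Suc (t + Suc j)) = \<langle>\<one> (tens_objs C X (Suc (t + j)) \<odot> ?D), ?h \<cdot> \<pi>\<^sub>2 (tens_objs C X (Suc (t + j))) ?D\<rangle> \<cdot>
      ?J \<cdot> (\<one> ?A \<otimes> future t j) \<cdot> chain (Suc t)"
    using Suc chain_Suc[of "Suc (t + j)"] by (simp del: hmm_chain.simps tens_join.simps)
  also have "\<dots> = \<langle>?J, ?h \<cdot> \<pi>\<^sub>2 ?B ?D \<cdot> \<pi>\<^sub>2 ?A (?B \<odot> ?D)\<rangle> \<cdot> (\<one> ?A \<otimes> future t j) \<cdot> chain (Suc t)"
    using Suc.prems by (simp add: pJ del: hmm_chain.simps tens_join.simps)
  \<comment> \<open>The new transition is moved inside the right block, where it is the next step of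
    \<open>future\<close>.\<close>
  also have "\<langle>?J, ?h \<cdot> \<pi>\<^sub>2 ?B ?D \<cdot> \<pi>\<^sub>2 ?A (?B \<odot> ?D)\<rangle>
      = (?J \<otimes> \<one> (Tgt C ?h)) \<cdot> \<alpha>i ?A (?B \<odot> ?D) (Tgt C ?h) \<cdot> (\<one> ?A \<otimes> \<langle>\<one> (?B \<odot> ?D), ?h \<cdot> \<pi>\<^sub>2 ?B ?D\<rangle>)"
    using Suc.prems by (simp add: pair_assoc_proj del: tens_join.simps)
  also have "\<dots> \<cdot> (\<one> ?A \<otimes> future t j) \<cdot> chain (Suc t)
      = tens_join C X (Suc t) (Suc (Suc j)) \<cdot> (\<one> ?A \<otimes> future t (Suc j)) \<cdot> chain (Suc t)"
    using Suc.prems by (simp add: tens_join.simps(2)[of C X "Suc t" "Suc j"] tens_comp_tail del: tens_join.simps hmm_chain.simps)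
  finally show ?case .
qed

text \<open>For any deterministic marginal this would be an instance of positivity, which holds in the
  presence of conditionals; for a chain it follows by induction.\<close>

lemma future_head:
  "t + j \<le> n \<Longrightarrow> \<langle>\<one> (tens_objs C (\<lambda>i. X (Suc (t + i))) j \<odot> X (Suc (t + j))), tens_proj (\<lambda>i. X (Suc (t + i))) 0 j\<rangle> \<cdot> future t j
    = \<langle>future t j, \<one> (X (Suc t))\<rangle>"
proof (induction j)
  case 0
  then show ?case by (simp add: lunit_inv_eq)
next
  case (Suc j)
  let ?A = "tens_objs C (\<lambda>i. X (Suc (t + i))) j \<odot> X (Suc (t + j))"
  let ?q = "tens_proj (\<lambda>i. X (Suc (t + i))) 0 j" and ?D = "X (Suc t)" and ?F = "future t j"
  let ?h = "f (Suc (Suc (t + j))) \<cdot> \<pi>\<^sub>2 (tens_objs C (\<lambda>i. X (Suc (t + i))) j) (X (Suc (t + j)))"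
  let ?B = "X (Suc (Suc (t + j)))"
  have h [simp]: "Src C ?h = ?A" "Tgt C ?h = ?B"
    and F [simp]: "Src C ?F = ?D" "Tgt C ?F = ?A"
    and q [simp]: "Src C ?q = ?A" "Tgt C ?q = ?D"
    using Suc.prems by auto
  have "\<langle>\<one> (?A \<odot> ?B), ?q \<cdot> \<pi>\<^sub>1 ?A ?B\<rangle> \<cdot> \<langle>\<one> ?A, ?h\<rangle> \<cdot> ?F = \<langle>\<langle>\<one> ?A, ?h\<rangle> \<cdot> ?F, \<one> ?D\<rangle>"
    using Suc h F q by (intro retain_input) (simp_all del: Src_comp Tgt_comp)
  then show ?case by simp
qed

section \<open>Joint state of past observations and two consecutive hidden states\<close>

text \<open>The state \<open>J\<close> of the opening outline, built on the marginal that the filter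
  disintegrates so that the filter can be substituted directly.\<close>

definition joint :: "nat \<Rightarrow> 'm" where
  "joint t = \<langle>\<one> (upto_objs C Y t \<odot> X t), f (Suc t) \<cdot> \<pi>\<^sub>2 (upto_objs C Y t) (X t)\<rangle> \<cdot>
     \<langle>obs t, tens_proj X t 0\<rangle> \<cdot> chain t"

lemma joint_hom [simp]:
  "t \<le> n \<Longrightarrow> Src C (joint t) = \<I>"
  "t \<le> n \<Longrightarrow> Tgt C (joint t) = (upto_objs C Y t \<odot> X t) \<odot> X (Suc t)"
  by (simp_all add: joint_def upto_objs_def del: hmm_chain.simps)

text \<open>The transition reads \<open>X t\<close> through a deterministic projection, so it may be
  performed before the random observations; it then becomes the last step of the chain.\<close>

lemma joint_eq_chain:
  assumes "t \<le> n"
  shows "joint t = (\<langle>obs t, \<pi>\<^sub>2 (tens_objs C X t) (X t)\<rangle> \<otimes> \<one> (X (Suc t))) \<cdot> chain (Suc t)"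
  using assms comp_tail[OF extend_pair[of "\<pi>\<^sub>2 (tens_objs C X t) (X t)" "obs t" "upto_objs C Y t" "X t" "f (Suc t)"], of "chain t"]
  by (simp add: joint_def chain_Suc upto_objs_def del: hmm_chain.simps)

text \<open>One kernel \<open>h\<close> serves both equations: it generates the later hidden states
  and observes them. Retaining \<open>X t\<close> beside it is direct; retaining
  \<open>X (Suc t)\<close> relies on \<open>future_head\<close>.\<close>

lemma factor_through_future:
  assumes "t \<le> n"
  obtains h where "Src C h = X (Suc t)" "Tgt C h = after_objs C Y t n"
    "\<langle>obs n, tens_proj X t (n - t)\<rangle> \<cdot> chain n =
      (tens_join C Y (Suc t) (n - t) \<otimes> \<one> (X t)) \<cdot> rotate (upto_objs C Y t) (X t) (after_objs C Y t n) \<cdot>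
      (\<one> (upto_objs C Y t \<odot> X t) \<otimes> h) \<cdot> joint t"
    "\<langle>obs n, if t < n then tens_proj X (Suc t) (n - Suc t) else del (tens_objs C X (Suc n))\<rangle> \<cdot> chain n =
      (tens_join C Y (Suc t) (n - t) \<otimes> \<one> (X (Suc t))) \<cdot>
      \<alpha>i (upto_objs C Y t) (after_objs C Y t n) (X (Suc t)) \<cdot>
      (\<one> (upto_objs C Y t) \<otimes> \<langle>h, \<one> (X (Suc t))\<rangle>) \<cdot>
      (\<pi>\<^sub>1 (upto_objs C Y t) (X t) \<otimes> \<one> (X (Suc t))) \<cdot> joint t"
proof (cases "t < n")
  case True
  then obtain j where n: "n = Suc (t + j)" using less_imp_Suc_add by auto
  let ?A = "tens_objs C X t \<odot> X t" and ?A' = "tens_objs C Y t \<odot> Y t" and ?D = "X (Suc t)"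
  let ?B = "tens_objs C (\<lambda>i. X (Suc t + i)) (Suc j)" and ?B' = "tens_objs C (\<lambda>i. Y (Suc t + i)) (Suc j)"
  define F where "F = future t j"
  define G where "G = obs t"
  define H where "H = tens_mors C (\<lambda>i. g (Suc t + i)) (Suc j)"
  define JX where "JX = tens_join C X (Suc t) (Suc j)"
  define JY where "JY = tens_join C Y (Suc t) (Suc j)"
  define q where "q = tens_proj (\<lambda>i. X (Suc t + i)) 0 j"
  define m where "m = chain (Suc t)"
  define O' where "O' = obs n"
  define x where "x = tens_proj X t (Suc j)"
  define x' where "x' = tens_proj X (Suc t) j"
  have [simp]: "Src C F = ?D" "Tgt C F = ?B" "Src C G = ?A" "Tgt C G = ?A'"
    "Src C JX = ?A \<odot> ?B" "Tgt C JX = tens_objs C X (Suc n)" "det JX"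
    "Src C JY = ?A' \<odot> ?B'" "Tgt C JY = tens_objs C Y (Suc n)"
    "Src C q = ?B" "Tgt C q = ?D" "Tgt C m = ?A \<odot> ?D"
    "Src C O' = tens_objs C X (Suc n)" "Tgt C O' = tens_objs C Y (Suc n)"
    "Src C x = tens_objs C X (Suc n)" "Tgt C x = X t"
    "Src C x' = tens_objs C X (Suc n)" "Tgt C x' = ?D"
    using n by (simp_all add: F_def G_def JX_def JY_def q_def m_def O'_def x_def x'_def del: hmm_chain.simps)
  have [simp]: "Src C H = ?B" "Tgt C H = ?B'"
    unfolding H_def using n by (auto simp del: tens_objs.simps tens_mors.simps intro!: Src_tens_mors Tgt_tens_mors)
  note [simp del] = tens_objs.simps
  have chain: "chain n = JX \<cdot> (\<one> ?A \<otimes> F) \<cdot> m"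
    using n chain_future[of t j] by (simp add: JX_def F_def m_def tens_objs.simps del: hmm_chain.simps)
  have nat: "JY \<cdot> (G \<otimes> H) = O' \<cdot> JX"
    unfolding JY_def JX_def G_def H_def O'_def
    using tens_join_natural[of "Suc t" "Suc j" g X Y] n by (simp del: tens_mors.simps)
  have x: "x \<cdot> JX = \<pi>\<^sub>2 (tens_objs C X t) (X t) \<cdot> \<pi>\<^sub>1 ?A ?B"
    unfolding x_def JX_def using tens_proj_join_left[of X t "Suc j"] by (simp add: tens_objs.simps)
  have x': "x' \<cdot> JX = q \<cdot> \<pi>\<^sub>2 ?A ?B"
    unfolding x'_def JX_def q_def using tens_proj_join_right[of X "Suc t" j] by (simp add: tens_objs.simps)
  \<comment> \<open>Reading \<open>X (Suc t)\<close> off the generated segment agrees with copying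
    it before the segment is generated.\<close>
  have qF: "\<langle>\<one> ?B, q\<rangle> \<cdot> F = \<langle>F, \<one> ?D\<rangle>"
    unfolding q_def F_def using future_head[of t j] n by (simp add: tens_objs.simps)
  have joint: "joint t = (\<langle>G, \<pi>\<^sub>2 (tens_objs C X t) (X t)\<rangle> \<otimes> \<one> ?D) \<cdot> m"
    unfolding G_def m_def using assms by (rule joint_eq_chain)
  have "\<langle>O', x\<rangle> \<cdot> chain n = (JY \<otimes> \<one> (X t)) \<cdot> \<langle>G \<otimes> H, \<pi>\<^sub>2 (tens_objs C X t) (X t) \<cdot> \<pi>\<^sub>1 ?A ?B\<rangle> \<cdot> (\<one> ?A \<otimes> F) \<cdot> m"
    by (simp add: chain nat x)
  also have "\<langle>G \<otimes> H, \<pi>\<^sub>2 (tens_objs C X t) (X t) \<cdot> \<pi>\<^sub>1 ?A ?B\<rangle>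
      = rotate ?A' (X t) ?B' \<cdot> (\<langle>G, \<pi>\<^sub>2 (tens_objs C X t) (X t)\<rangle> \<otimes> H)"
    by (simp add: rotate_tens_pair)
  also have "(JY \<otimes> \<one> (X t)) \<cdot> \<dots> \<cdot> (\<one> ?A \<otimes> F) \<cdot> m
      = (JY \<otimes> \<one> (X t)) \<cdot> rotate ?A' (X t) ?B' \<cdot> (\<one> (?A' \<odot> X t) \<otimes> (H \<cdot> F)) \<cdot> joint t"
    by (simp add: joint tens_comp_tail)
  finally have 1: "\<langle>O', x\<rangle> \<cdot> chain n = (JY \<otimes> \<one> (X t)) \<cdot> rotate ?A' (X t) ?B' \<cdot> (\<one> (?A' \<odot> X t) \<otimes> (H \<cdot> F)) \<cdot> joint t" .
  have "\<langle>H, q\<rangle> \<cdot> F = (H \<otimes> \<one> ?D) \<cdot> \<langle>\<one> ?B, q\<rangle> \<cdot> F"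
    by simp
  then have HqF: "\<langle>H, q\<rangle> \<cdot> F = \<langle>H \<cdot> F, \<one> ?D\<rangle>"
    unfolding qF by simp
  have "\<langle>O', x'\<rangle> \<cdot> chain n = (JY \<otimes> \<one> ?D) \<cdot> \<langle>G \<otimes> H, q \<cdot> \<pi>\<^sub>2 ?A ?B\<rangle> \<cdot> (\<one> ?A \<otimes> F) \<cdot> m"
    by (simp add: chain nat x')
  also have "\<langle>G \<otimes> H, q \<cdot> \<pi>\<^sub>2 ?A ?B\<rangle> = \<alpha>i ?A' ?B' ?D \<cdot> (G \<otimes> \<langle>H, q\<rangle>)"
    by (simp add: assoc_inv_tens_pair)
  also have "(JY \<otimes> \<one> ?D) \<cdot> \<dots> \<cdot> (\<one> ?A \<otimes> F) \<cdot> m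
      = (JY \<otimes> \<one> ?D) \<cdot> \<alpha>i ?A' ?B' ?D \<cdot> (\<one> ?A' \<otimes> \<langle>H \<cdot> F, \<one> ?D\<rangle>) \<cdot> (\<pi>\<^sub>1 ?A' (X t) \<otimes> \<one> ?D) \<cdot> joint t"
    by (simp add: joint tens_comp_tail HqF)
  finally have 2: "\<langle>O', x'\<rangle> \<cdot> chain n
      = (JY \<otimes> \<one> ?D) \<cdot> \<alpha>i ?A' ?B' ?D \<cdot> (\<one> ?A' \<otimes> \<langle>H \<cdot> F, \<one> ?D\<rangle>) \<cdot> (\<pi>\<^sub>1 ?A' (X t) \<otimes> \<one> ?D) \<cdot> joint t" .
  have nt: "n - t = Suc j" "n - Suc t = j"
    using n by auto
  have objs: "upto_objs C Y t = ?A'" "after_objs C Y t n = ?B'"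
    by (simp_all add: upto_objs_def after_objs_def nt tens_objs.simps)
  \<comment> \<open>The witness runs the hidden chain from \<open>X (Suc t)\<close> by
    \<open>F\<close> and then observes every state by \<open>H\<close>.\<close>
  show thesis
  proof (rule that[of "H \<cdot> F"])
    show "Src C (H \<cdot> F) = ?D" "Tgt C (H \<cdot> F) = after_objs C Y t n"
      by (simp_all add: objs)
  qed (use 1 2 True in \<open>unfold nt objs O'_def x_def x'_def JY_def, simp_all only: if_True\<close>)
next
  case False
  with assms have t: "t = n" by simp
  let ?A = "tens_objs C Y n \<odot> Y n" and ?M = "\<langle>obs n, \<pi>\<^sub>2 (tens_objs C X n) (X n)\<rangle>"
  have f: "f (Suc n) = del (X n)"
    by (rule into_unit_eq) (simp_all add: last_unit)
  have joint: "joint n = \<langle>\<one> (?A \<odot> X n), del (?A \<odot> X n)\<rangle> \<cdot> ?M \<cdot> chain n"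
    by (simp add: joint_def upto_objs_def f del: hmm_chain.simps tens_mors.simps)
  have objs: "upto_objs C Y n = ?A" "after_objs C Y n n = \<I>"
    by (simp_all add: upto_objs_def after_objs_def)
  have 1: "(\<rr> ?A \<otimes> \<one> (X n)) \<cdot> rotate ?A (X n) \<I> \<cdot> \<langle>\<one> (?A \<odot> X n), del (?A \<odot> X n)\<rangle> = \<one> (?A \<odot> X n)"
    by (simp add: rotate_def struct_eq tens_eq_pair)
  have 2: "(\<rr> ?A \<otimes> \<one> \<I>) \<cdot> \<alpha>i ?A \<I> \<I> \<cdot> (\<one> ?A \<otimes> \<langle>\<one> \<I>, \<one> \<I>\<rangle>) \<cdot> (\<pi>\<^sub>1 ?A (X n) \<otimes> \<one> \<I>) \<cdot> \<langle>\<one> (?A \<odot> X n), del (?A \<odot> X n)\<rangle>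
      = \<langle>\<one> ?A, del ?A\<rangle> \<cdot> \<pi>\<^sub>1 ?A (X n)"
    by (simp add: struct_eq tens_eq_pair)
  \<comment> \<open>At \<open>t = n\<close> there are no later observations and
    \<open>X (Suc n)\<close> is the unit, so \<open>h\<close> is the identity of
    \<open>\<I>\<close>.\<close>
  show thesis
  proof (rule that[of "\<one> \<I>"], unfold t objs joint last_unit)
    show "\<langle>obs n, tens_proj X n (n - n)\<rangle> \<cdot> chain n =
      (tens_join C Y (Suc n) (n - n) \<otimes> \<one> (X n)) \<cdot> rotate ?A (X n) \<I> \<cdot>
      (\<one> (?A \<odot> X n) \<otimes> \<one> \<I>) \<cdot> \<langle>\<one> (?A \<odot> X n), del (?A \<odot> X n)\<rangle> \<cdot> ?M \<cdot> chain n"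
      using comp_tail[of "(\<rr> ?A \<otimes> \<one> (X n)) \<cdot> rotate ?A (X n) \<I>" "\<langle>\<one> (?A \<odot> X n), del (?A \<odot> X n)\<rangle>" "\<one> (?A \<odot> X n)" "?M \<cdot> chain n"] 1
      by (simp add: tens_ident del: hmm_chain.simps tens_mors.simps)
    show "\<langle>obs n, if n < n then tens_proj X (Suc n) (n - Suc n) else del (tens_objs C X (Suc n))\<rangle> \<cdot> chain n =
      (tens_join C Y (Suc n) (n - n) \<otimes> \<one> \<I>) \<cdot> \<alpha>i ?A \<I> \<I> \<cdot> (\<one> ?A \<otimes> \<langle>\<one> \<I>, \<one> \<I>\<rangle>) \<cdot>
      (\<pi>\<^sub>1 ?A (X n) \<otimes> \<one> \<I>) \<cdot> \<langle>\<one> (?A \<odot> X n), del (?A \<odot> X n)\<rangle> \<cdot> ?M \<cdot> chain n"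
    proof -
      \<comment> \<open>Since \<open>obs n\<close> may be random, the pairing is moved past it by
        \<open>pair_del\<close> instead of by distribution.\<close>
      have "\<langle>obs n, del (tens_objs C X (Suc n))\<rangle> \<cdot> chain n = \<langle>\<one> ?A, del ?A\<rangle> \<cdot> obs n \<cdot> chain n"
        using comp_tail[OF pair_del[of "obs n" ?A], of "chain n"] by (simp del: hmm_chain.simps tens_mors.simps)
      also have "\<dots> = (\<langle>\<one> ?A, del ?A\<rangle> \<cdot> \<pi>\<^sub>1 ?A (X n)) \<cdot> ?M \<cdot> chain n"
        by (subst comp_assoc') (simp_all del: hmm_chain.simps tens_mors.simps det_pair_comp det_pair_comp_tail)
      finally show ?thesis
        unfolding 2[symmetric] by (simp del: hmm_chain.simps tens_mors.simps det_pair_comp_tail)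
    qed
  qed simp_all
qed

text \<open>The defining equation of \<open>k\<close> is an equality of kernels on the past
  observations, so it may be applied beside a retained copy of them. The copy read by
  \<open>k\<close> and the retained copy then merge into the first component of the marginal on past
  observations and \<open>X (Suc t)\<close>.\<close>

lemma joint_conditional:
  assumes t: "t \<le> n"
    and BF: "bayes_filter C n X Y (state n) t b"
    and k: "is_conditional C (upto_objs C Y t) (X t) (X (Suc t)) ((\<one> (X t) \<otimes> f (Suc t)) \<cdot> copy (X t) \<cdot> b) k"
  shows "joint t = \<langle>\<langle>\<pi>\<^sub>1 (upto_objs C Y t) (X (Suc t)), k\<rangle>, \<pi>\<^sub>2 (upto_objs C Y t) (X (Suc t))\<rangle> \<cdot>
    (\<pi>\<^sub>1 (upto_objs C Y t) (X t) \<otimes> \<one> (X (Suc t))) \<cdot> joint t"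
proof -
  let ?A = "upto_objs C Y t" and ?B = "X t" and ?D = "X (Suc t)" and ?f = "f (Suc t)"
  define y where "y = obs t \<cdot> chain t"
  note b = posteriorD[OF BF[unfolded bayes_filter_def] order.refl t]
  have [simp]: "Src C b = ?A" "Tgt C b = ?B" "Src C ?f = ?B" "Tgt C ?f = ?D" "Tgt C y = ?A"
    using b t by (simp_all add: y_def upto_objs_def del: hmm_chain.simps)
  have [simp]: "Src C k = ?A \<odot> ?D" "Tgt C k = ?B"
    using k by (simp_all add: is_conditional_def Hom_def)
  have k': "\<langle>\<one> ?B, ?f\<rangle> \<cdot> b = \<langle>k, \<pi>\<^sub>2 ?A ?D\<rangle> \<cdot> \<langle>\<one> ?A, ?f \<cdot> b\<rangle>"
    using k by (simp add: conditional_iff tens_copy_tail)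
  have joint: "joint t = \<langle>\<one> (?A \<odot> ?B), ?f \<cdot> \<pi>\<^sub>2 ?A ?B\<rangle> \<cdot> \<langle>\<one> ?A, b\<rangle> \<cdot> y"
    using b(3) by (simp add: joint_def y_def del: hmm_chain.simps tens_mors.simps)
  have "(\<pi>\<^sub>1 ?A ?B \<otimes> \<one> ?D) \<cdot> joint t = (\<one> ?A \<otimes> ?f) \<cdot> \<langle>\<one> ?A, b\<rangle> \<cdot> y"
    by (simp add: joint tens_eq_pair[of "\<one> ?A" ?f] del: pair_tail(3)) simp
  also have "\<dots> = \<langle>\<one> ?A, ?f \<cdot> b\<rangle> \<cdot> y"
    by simp
  finally have K: "(\<pi>\<^sub>1 ?A ?B \<otimes> \<one> ?D) \<cdot> joint t = \<langle>\<one> ?A, ?f \<cdot> b\<rangle> \<cdot> y" .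
  have "joint t = \<alpha>i ?A ?B ?D \<cdot> \<langle>\<one> ?A, \<langle>\<one> ?B, ?f\<rangle> \<cdot> b\<rangle> \<cdot> y"
    by (simp add: joint extend_snd)
  also have "\<langle>\<one> ?A, \<langle>\<one> ?B, ?f\<rangle> \<cdot> b\<rangle> = (\<one> ?A \<otimes> \<langle>k, \<pi>\<^sub>2 ?A ?D\<rangle>) \<cdot> \<langle>\<one> ?A, \<langle>\<one> ?A, ?f \<cdot> b\<rangle>\<rangle>"
    by (simp add: k')
  \<comment> \<open>Only the deterministic identity is duplicated, so \<open>retain_fst\<close>
    applies although \<open>b\<close> and the transition may be random.\<close>
  also have "\<dots> = (\<one> ?A \<otimes> \<langle>k, \<pi>\<^sub>2 ?A ?D\<rangle>) \<cdot> \<langle>\<pi>\<^sub>1 ?A ?D, \<one> (?A \<odot> ?D)\<rangle> \<cdot> \<langle>\<one> ?A, ?f \<cdot> b\<rangle>"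
    by (subst retain_fst) simp_all
  also have "\<dots> = \<langle>\<pi>\<^sub>1 ?A ?D, \<langle>k, \<pi>\<^sub>2 ?A ?D\<rangle>\<rangle> \<cdot> \<langle>\<one> ?A, ?f \<cdot> b\<rangle>"
    by simp
  also have "\<alpha>i ?A ?B ?D \<cdot> \<dots> \<cdot> y = \<langle>\<langle>\<pi>\<^sub>1 ?A ?D, k\<rangle>, \<pi>\<^sub>2 ?A ?D\<rangle> \<cdot> \<langle>\<one> ?A, ?f \<cdot> b\<rangle> \<cdot> y"
    by (simp add: assoc_pair_tail)
  finally show ?thesis
    unfolding K .
qed

section \<open>The backward recursion\<close>

text \<open>Both sides, paired with all observations, are computed from the same state
  \<open>K\<close> of past observations and \<open>X (Suc t)\<close>: \<open>h\<close> produces the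
  later observations and \<open>k\<close> produces \<open>X t\<close>, with no interaction between
  the two.\<close>

lemma backward_recursion:
  assumes t: "t \<le> n"
    and BF: "bayes_filter C n X Y (state n) t b"
    and BS: "bayes_smoother C n X Y (state n) t s"
    and BS': "t < n \<Longrightarrow> bayes_smoother C n X Y (state n) (Suc t) s'"
    and last: "t = n \<Longrightarrow> s' = del (upto_objs C Y n)"
    and k: "is_conditional C (upto_objs C Y t) (X t) (X (Suc t)) ((\<one> (X t) \<otimes> f (Suc t)) \<cdot> copy (X t) \<cdot> b) k"
  shows "as_equal C (upto_objs C Y n) (marginal_Y C n X Y n (state n)) s
    (k \<cdot> (\<one> (upto_objs C Y t) \<otimes> s') \<cdot> copy_upto C Y t n)"
proof -
  let ?A = "upto_objs C Y t" and ?B = "after_objs C Y t n" and ?D = "X (Suc t)" and ?Y = "upto_objs C Y n"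
  obtain h where [simp]: "Src C h = ?D" "Tgt C h = ?B"
    and past: "\<langle>obs n, tens_proj X t (n - t)\<rangle> \<cdot> chain n =
      (tens_join C Y (Suc t) (n - t) \<otimes> \<one> (X t)) \<cdot> rotate ?A (X t) ?B \<cdot> (\<one> (?A \<odot> X t) \<otimes> h) \<cdot> joint t"
    and future: "\<langle>obs n, if t < n then tens_proj X (Suc t) (n - Suc t) else del (tens_objs C X (Suc n))\<rangle> \<cdot> chain n =
      (tens_join C Y (Suc t) (n - t) \<otimes> \<one> ?D) \<cdot> \<alpha>i ?A ?B ?D \<cdot> (\<one> ?A \<otimes> \<langle>h, \<one> ?D\<rangle>) \<cdot> (\<pi>\<^sub>1 ?A (X t) \<otimes> \<one> ?D) \<cdot> joint t"
    using factor_through_future[OF t] .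
  define J where "J = tens_join C Y (Suc t) (n - t)"
  \<comment> \<open>\<open>r\<close> reads the past block off all observations; with it,
    \<open>copy_upto\<close> is the pairing of \<open>r\<close> with the identity.\<close>
  define r where "r = \<pi>\<^sub>1 ?A ?B \<cdot> tens_split C Y (Suc t) (n - t)"
  define y where "y = obs n \<cdot> chain n"
  define K where "K = (\<pi>\<^sub>1 ?A (X t) \<otimes> \<one> ?D) \<cdot> joint t"
  note s = posteriorD[OF BS[unfolded bayes_smoother_def] t order.refl]
  \<comment> \<open>For \<open>t = n\<close> both the readout of the hidden states and
    \<open>s'\<close> are deletions, so the last step has the same form as the others.\<close>
  have s': "Src C s' = ?Y" "Tgt C s' = ?D"
    "\<langle>obs n, if t < n then tens_proj X (Suc t) (n - Suc t) else del (tens_objs C X (Suc n))\<rangle> \<cdot> chain n = \<langle>\<one> ?Y, s'\<rangle> \<cdot> y"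
  proof (atomize (full), cases "t < n")
    case True
    then show "Src C s' = ?Y \<and> Tgt C s' = ?D \<and> \<langle>obs n, if t < n then tens_proj X (Suc t) (n - Suc t) else del (tens_objs C X (Suc n))\<rangle> \<cdot> chain n = \<langle>\<one> ?Y, s'\<rangle> \<cdot> y"
      using posteriorD[OF BS'[unfolded bayes_smoother_def]] by (simp add: y_def del: hmm_chain.simps tens_mors.simps)
  next
    case False
    with t have "t = n" by simp
    then show "Src C s' = ?Y \<and> Tgt C s' = ?D \<and> \<langle>obs n, if t < n then tens_proj X (Suc t) (n - Suc t) else del (tens_objs C X (Suc n))\<rangle> \<cdot> chain n = \<langle>\<one> ?Y, s'\<rangle> \<cdot> y"
      using last comp_tail[OF pair_del[of "obs n" ?Y], of "chain n"]
      by (simp add: y_def upto_objs_def last_unit del: hmm_chain.simps tens_mors.simps)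
  qed
  have [simp]: "Src C s = ?Y" "Tgt C s = X t" "Src C s' = ?Y" "Tgt C s' = ?D"
    by (fact s s')+
  have [simp]: "Src C k = ?A \<odot> ?D" "Tgt C k = X t"
    using k by (simp_all add: is_conditional_def Hom_def)
  have [simp]: "Tgt C y = ?Y" "Tgt C K = ?A \<odot> ?D"
    "Src C J = ?A \<odot> ?B" "Tgt C J = ?Y" "det J" "Src C r = ?Y" "Tgt C r = ?A" "det r"
    using t by (simp_all add: y_def K_def J_def r_def upto_objs_def after_objs_def del: hmm_chain.simps)
  have rJ: "r \<cdot> J = \<pi>\<^sub>1 ?A ?B"
    using tens_split_join[of Y "Suc t" "n - t"] by (simp add: r_def J_def upto_objs_def after_objs_def)
  let ?R = "k \<cdot> (\<one> ?A \<otimes> s') \<cdot> copy_upto C Y t n"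
  have R: "?R = k \<cdot> \<langle>r, s'\<rangle>"
    using t by (simp add: copy_upto_eq r_def[symmetric])
  have joint: "joint t = \<langle>\<langle>\<pi>\<^sub>1 ?A ?D, k\<rangle>, \<pi>\<^sub>2 ?A ?D\<rangle> \<cdot> K"
    unfolding K_def using t BF k by (rule joint_conditional)
  have left: "\<langle>\<one> ?Y, s\<rangle> \<cdot> y = \<langle>J \<cdot> \<langle>\<pi>\<^sub>1 ?A ?D, h \<cdot> \<pi>\<^sub>2 ?A ?D\<rangle>, k\<rangle> \<cdot> K"
  proof -
    have "\<langle>\<one> ?Y, s\<rangle> \<cdot> y = (J \<otimes> \<one> (X t)) \<cdot> rotate ?A (X t) ?B \<cdot> (\<one> (?A \<odot> X t) \<otimes> h) \<cdot> \<langle>\<langle>\<pi>\<^sub>1 ?A ?D, k\<rangle>, \<pi>\<^sub>2 ?A ?D\<rangle> \<cdot> K"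
      using s(3) past by (simp only: y_def J_def joint[symmetric])
    also have "\<dots> = ((J \<otimes> \<one> (X t)) \<cdot> rotate ?A (X t) ?B \<cdot> \<langle>\<langle>\<pi>\<^sub>1 ?A ?D, k\<rangle>, h \<cdot> \<pi>\<^sub>2 ?A ?D\<rangle>) \<cdot> K"
      by simp
    also have "\<dots> = \<langle>J \<cdot> \<langle>\<pi>\<^sub>1 ?A ?D, h \<cdot> \<pi>\<^sub>2 ?A ?D\<rangle>, k\<rangle> \<cdot> K"
      by (subst rotate_pair) simp_all
    finally show ?thesis .
  qed
  have right: "\<langle>\<one> ?Y, k \<cdot> \<langle>r, s'\<rangle>\<rangle> \<cdot> y = \<langle>J \<cdot> \<langle>\<pi>\<^sub>1 ?A ?D, h \<cdot> \<pi>\<^sub>2 ?A ?D\<rangle>, k\<rangle> \<cdot> K"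
  proof -
    \<comment> \<open>\<open>?r\<close> keeps all observations and assembles the input of
      \<open>k\<close>. Written as in \<open>r\<close>, it duplicates only the observations, so the
      possibly random \<open>s'\<close> is run once.\<close>
    let ?r = "\<langle>\<pi>\<^sub>1 ?Y ?D, \<langle>r \<cdot> \<pi>\<^sub>1 ?Y ?D, \<pi>\<^sub>2 ?Y ?D\<rangle>\<rangle>" and ?BD = "?B \<odot> ?D"
    have r: "?r = \<alpha> ?Y ?A ?D \<cdot> (\<langle>\<one> ?Y, r\<rangle> \<otimes> \<one> ?D)"
      by (simp add: assoc_pair tens_eq_pair)
    have "\<langle>\<one> ?Y, k \<cdot> \<langle>r, s'\<rangle>\<rangle> = (\<one> ?Y \<otimes> k) \<cdot> \<langle>\<one> ?Y, \<langle>r, s'\<rangle>\<rangle>"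
      by simp
    also have "\<langle>\<one> ?Y, \<langle>r, s'\<rangle>\<rangle> = ?r \<cdot> \<langle>\<one> ?Y, s'\<rangle>"
      unfolding r by (simp add: assoc_pair)
    finally have "\<langle>\<one> ?Y, k \<cdot> \<langle>r, s'\<rangle>\<rangle> \<cdot> y = (\<one> ?Y \<otimes> k) \<cdot> ?r \<cdot> \<langle>\<one> ?Y, s'\<rangle> \<cdot> y"
      by (simp del: tens_pair pair_tail)
    also have "\<langle>\<one> ?Y, s'\<rangle> \<cdot> y = (J \<otimes> \<one> ?D) \<cdot> \<alpha>i ?A ?B ?D \<cdot> (\<one> ?A \<otimes> \<langle>h, \<one> ?D\<rangle>) \<cdot> K"
      using s'(3) future by (simp only: J_def K_def)
    also have "(\<one> ?Y \<otimes> k) \<cdot> ?r \<cdot> \<dots> = (\<one> ?Y \<otimes> k) \<cdot> (?r \<cdot> (J \<otimes> \<one> ?D) \<cdot> \<alpha>i ?A ?B ?D) \<cdot> (\<one> ?A \<otimes> \<langle>h, \<one> ?D\<rangle>) \<cdot> K"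
      by (simp del: tens_pair pair_tail)
    \<comment> \<open>This part is deterministic and can be compared through projections; by
      \<open>rJ\<close>, reading the past block back from the joined observations is the first
      projection.\<close>
    also have "?r \<cdot> (J \<otimes> \<one> ?D) \<cdot> \<alpha>i ?A ?B ?D = (J \<otimes> \<one> (?A \<odot> ?D)) \<cdot>
        \<langle>\<langle>\<pi>\<^sub>1 ?A ?BD, \<pi>\<^sub>1 ?B ?D \<cdot> \<pi>\<^sub>2 ?A ?BD\<rangle>, \<langle>\<pi>\<^sub>1 ?A ?BD, \<pi>\<^sub>2 ?B ?D \<cdot> \<pi>\<^sub>2 ?A ?BD\<rangle>\<rangle>"
      by (simp add: assoc_inv_eq comp_tail[OF rJ])
    also have "(\<one> ?Y \<otimes> k) \<cdot> \<dots> \<cdot> (\<one> ?A \<otimes> \<langle>h, \<one> ?D\<rangle>) \<cdot> K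
        = (\<one> ?Y \<otimes> k) \<cdot> (J \<otimes> \<one> (?A \<odot> ?D)) \<cdot> (\<langle>\<langle>\<pi>\<^sub>1 ?A ?BD, \<pi>\<^sub>1 ?B ?D \<cdot> \<pi>\<^sub>2 ?A ?BD\<rangle>, \<langle>\<pi>\<^sub>1 ?A ?BD, \<pi>\<^sub>2 ?B ?D \<cdot> \<pi>\<^sub>2 ?A ?BD\<rangle>\<rangle> \<cdot> (\<one> ?A \<otimes> \<langle>h, \<one> ?D\<rangle>)) \<cdot> K"
      by (simp del: tens_pair pair_tail det_pair_comp det_pair_comp_tail)
    \<comment> \<open>Here \<open>distribute_fst\<close> sends the output of \<open>h\<close> to the
      observations alone, while \<open>k\<close> receives the past block and
      \<open>X (Suc t)\<close>.\<close>
    also have "\<dots> = \<langle>J \<cdot> \<langle>\<pi>\<^sub>1 ?A ?D, h \<cdot> \<pi>\<^sub>2 ?A ?D\<rangle>, k\<rangle> \<cdot> K"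
      by (subst distribute_fst) simp_all
    finally show ?thesis .
  qed
  have "(\<one> ?Y \<otimes> s) \<cdot> copy ?Y \<cdot> y = (\<one> ?Y \<otimes> (k \<cdot> \<langle>r, s'\<rangle>)) \<cdot> copy ?Y \<cdot> y"
    by (simp add: tens_copy_tail left right)
  then show ?thesis
    unfolding as_equal_def R marginal_Y_eq y_def .
qed

end

theorem proposition5p9:
  fixes C :: "('o, 'm, 'z) markov_data_scheme" (structure)
    and n :: nat
    and X Y :: "nat \<Rightarrow> 'o"
    and f g BF BS k :: "nat \<Rightarrow> 'm"
    and p :: 'm
  assumes "markov_category C"
    and "has_conditionals C"
    and "hmm_kernels C n X Y f g"
    and "p = hmm_state C n X f g"
    and "\<forall>t\<le>n. bayes_filter C n X Y p t (BF t)"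
    and "\<forall>t\<le>n. bayes_smoother C n X Y p t (BS t)"
    and "X (Suc n) = \<I>"
    and "f (Suc n) = del (X n)"
    and "BS (Suc n) = del (upto_objs C Y n)"
    and "\<forall>t\<le>n. is_conditional C (upto_objs C Y t) (X t) (X (Suc t))
           ((\<one> (X t) \<otimes> f (Suc t)) \<cdot> copy (X t) \<cdot> BF t) (k t)"
  shows "\<forall>t\<le>n. as_equal C (upto_objs C Y n) (marginal_Y C n X Y n p)
           (BS t)
           (k t \<cdot> (\<one> (upto_objs C Y t) \<otimes> BS (Suc t)) \<cdot> copy_upto C Y t n)"
proof -
  interpret markov_category C by fact
  \<comment> \<open>For \<open>t = n\<close> the types come from the conventions for
    \<open>X (Suc n)\<close> and \<open>f (Suc n)\<close>, since the kernel assumption stops at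
    \<open>n\<close>.\<close>
  have trans: "Src C (f (Suc t)) = X t \<and> Tgt C (f (Suc t)) = X (Suc t)" if "t \<le> n" for t
    using that assms(3,7,8) by (cases "t = n") (auto simp: hmm_kernels_def Hom_def)
  interpret hidden_markov C n X Y f g
    using assms(3,7) trans by unfold_locales (auto simp: hmm_kernels_def Hom_def)
  show ?thesis
    using assms by (auto intro!: backward_recursion)
qed

end
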